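(* (i) For any $\beta>0$ and integer $d\ge1$ there exists a finite constant $C_1=C_1(\beta,d)$ such that $$\mathsf{TV}(\mu,\nu)^{\frac{2\beta+d+1}{2\beta}}\le C_1\,\big(\|\mu\|_{\beta,2}^2+\|\nu\|_{\beta,2}^2\big)^{\frac{d+1}{4\beta}}\;\overline{d_H}(\mu,\nu)$$ for all $\mu,\nu\in\mathcal P_S(\beta,d,\infty)$. (ii) For any integer $d\ge1$ there exists a finite constant $C_2=C_2(d)$ such that $$\mathsf{TV}(\mu,\nu)\,\log\Big(3+\frac1{\mathsf{TV}(\mu,\nu)}\Big)^{-\frac{d+1}{2}}\le C_2\,\overline{d_H}(\mu,\nu)$$ for all $\mu,\nu\in\mathcal P_G(d)$ (the left side is read as $0$ when $\mathsf{TV}(\mu,\nu)=0$).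
   Context: $\mathbb B(0,1)$ is the closed Euclidean unit ball of $\mathbb R^d$. Fourier transform: $\widehat f(\omega)=\int_{\mathbb R^d}e^{-i\langle x,\omega\rangle}f(x)\,dx$. For $f\in L^2(\mathbb R^d)$, $\|f\|_{\beta,2}^2=\int_{\mathbb R^d}\|\omega\|^{2\beta}|\widehat f(\omega)|^2\,d\omega$; for a distribution $\mu$ with density $p$, $\|\mu\|_{\beta,2}=\|p\|_{\beta,2}$. $\mathcal P_S(\beta,d,\infty)$ is the set of probability distributions on $\mathbb R^d$ supported in $\mathbb B(0,1)$ having a density $p\in L^2(\mathbb R^d)$ with $\|p\|_{\beta,2}<\infty$. $\mathcal P_G(d)=\{\rho*\mathcal N(0,I_d):\rho \text{ a probability distribution with }\operatorname{supp}(\rho)\subseteq\mathbb B(0,1)\}$. $\mathsf{TV}(\mu,\nu)=\sup_{A}[\mu(A)-\nu(A)]$ over measurable sets. The perceptron discrepancy is $\overline{d_H}(\mu,\nu)=\sup_{v\in\mathbb R^d,\,b\in\mathbb R}\big\{\mu(\{x:x^\top v\ge b\})-\nu(\{x:x^\top v\ge b\})\big\}$. *)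

theory Defs
  imports "HOL-Probability.Probability"
begin

text \<open>
  The integral converges absolutely for integrable \<open>f\<close>. For a general square integrable \<open>f\<close> one
  would need the Plancherel extension; below the transform is only taken of probability densities,
  which are integrable.
\<close>

definition fourier :: "('a::euclidean_space \<Rightarrow> real) \<Rightarrow> 'a \<Rightarrow> complex" where
  "fourier f \<omega> = (LINT x|lborel. exp (- \<i> * of_real (x \<bullet> \<omega>)) * of_real (f x))"

definition sobolev_energy :: "real \<Rightarrow> ('a::euclidean_space \<Rightarrow> real) \<Rightarrow> ennreal" where
  "sobolev_energy \<beta> f =
    (\<integral>\<^sup>+\<omega>. ennreal (norm \<omega> powr (2 * \<beta>) * (cmod (fourier f \<omega>))\<^sup>2) \<partial>lborel)"

text \<open>
  The seminorm is real valued and hence meaningful only where the energy is finite; finiteness is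
  always required through \<^const>\<open>sobolev_energy\<close> itself.
\<close>

definition sobolev_norm :: "real \<Rightarrow> ('a::euclidean_space \<Rightarrow> real) \<Rightarrow> real" where
  "sobolev_norm \<beta> f = sqrt (enn2real (sobolev_energy \<beta> f))"

definition is_density :: "('a::euclidean_space) measure \<Rightarrow> ('a \<Rightarrow> real) \<Rightarrow> bool" where
  "is_density \<mu> p \<longleftrightarrow>
    p \<in> borel_measurable borel \<and> (\<forall>x. 0 \<le> p x) \<and> \<mu> = density lborel (\<lambda>x. ennreal (p x))"

definition measure_sobolev_norm :: "real \<Rightarrow> ('a::euclidean_space) measure \<Rightarrow> real" where
  "measure_sobolev_norm \<beta> \<mu> = sobolev_norm \<beta> (\<lambda>x. enn2real (RN_deriv lborel \<mu> x))"

text \<open>Any two densities agree almost everywhere, so the choice of density is immaterial.\<close>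

lemma measure_sobolev_norm_density:
  fixes \<mu> :: "('a::euclidean_space) measure"
  assumes "is_density \<mu> p"
  shows "measure_sobolev_norm \<beta> \<mu> = sobolev_norm \<beta> p"
proof -
  have p: "p \<in> borel_measurable borel" "\<And>x. 0 \<le> p x"
    and \<mu>: "density lborel (\<lambda>x. ennreal (p x)) = \<mu>"
    using assms by (auto simp: is_density_def)
  have "AE x in lborel. ennreal (p x) = RN_deriv lborel \<mu> x"
    using p \<mu> by (intro sigma_finite_measure.RN_deriv_unique[OF sigma_finite_lborel]) auto
  then have "AE x in lborel. enn2real (RN_deriv lborel \<mu> x) = p x"
    by eventually_elim (metis enn2real_ennreal p(2))
  then have "fourier (\<lambda>x. enn2real (RN_deriv lborel \<mu> x)) \<omega> = fourier p \<omega>" for \<omega>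
    unfolding fourier_def using p(1) by (intro integral_cong_AE) auto
  then show ?thesis
    by (simp add: measure_sobolev_norm_def sobolev_norm_def sobolev_energy_def)
qed

definition msupport :: "('a::topological_space) measure \<Rightarrow> 'a set" where
  "msupport \<mu> = {x. \<forall>U. open U \<and> x \<in> U \<longrightarrow> emeasure \<mu> U > 0}"

definition prob_dist :: "('a::topological_space) measure \<Rightarrow> bool" where
  "prob_dist \<mu> \<longleftrightarrow> prob_space \<mu> \<and> sets \<mu> = sets borel"

definition smooth_class :: "real \<Rightarrow> ('a::euclidean_space) measure set" where
  "smooth_class \<beta> = {\<mu>. prob_dist \<mu> \<and> msupport \<mu> \<subseteq> cball 0 1 \<and>
    (\<exists>p. is_density \<mu> p \<and> integrable lborel (\<lambda>x. (p x)\<^sup>2) \<and> sobolev_energy \<beta> p < \<infinity>)}"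

definition std_gaussian :: "('a::euclidean_space) measure" where
  "std_gaussian =
    density lborel (\<lambda>x. ennreal ((2 * pi) powr (- real DIM('a) / 2) * exp (- (norm x)\<^sup>2 / 2)))"

definition gaussian_mixture_class :: "('a::ordered_euclidean_space) measure set" where
  "gaussian_mixture_class =
    {convolution \<rho> std_gaussian | \<rho>. prob_dist \<rho> \<and> msupport \<rho> \<subseteq> cball 0 1}"

text \<open>
  Both suprema range over non-empty subsets of \<open>[-1, 1]\<close> whenever the
  arguments are probability measures on the Borel sets, so the conditionally complete supremum is
  the true one.
\<close>

definition total_variation :: "('a::topological_space) measure \<Rightarrow> 'a measure \<Rightarrow> real" where
  "total_variation \<mu> \<nu> = (SUP A\<in>sets borel. measure \<mu> A - measure \<nu> A)"

definition perceptron_discrepancy :: "('a::euclidean_space) measure \<Rightarrow> 'a measure \<Rightarrow> real" where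
  "perceptron_discrepancy \<mu> \<nu> =
    (SUP (v, b)\<in>UNIV. measure \<mu> {x. x \<bullet> v \<ge> b} - measure \<nu> {x. x \<bullet> v \<ge> b})"

end

theory Submission
  imports Defs
begin

text \<open>
  Let \<open>f = \<mu> - \<nu>\<close>. On the ray through \<open>v\<close>, the Fourier transform of \<open>f\<close> is \<open>- i t\<close> times that of the
  one-dimensional half-space profile \<open>b \<mapsto> f {x. x \<bullet> v \<ge> b}\<close>, which is bounded by the perceptron
  discrepancy \<open>D\<close>. Plancherel on the line, averaged over \<open>T \<le> t \<le> 2 * T\<close> and over \<open>v\<close> in the unit ball,
  bounds the energy of the transform of \<open>f\<close> on frequencies below \<open>T\<close> by a multiple of
  \<open>T ^ (d + 1) * D * W\<close>, where \<open>W\<close> bounds the \<open>L\<^sup>1\<close> norms of the profiles; averaging over \<open>v\<close> replaces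
  polar coordinates. The high frequencies are controlled by the Sobolev energy or by the Gaussian
  decay. Conversely, by Plancherel and Cauchy--Schwarz, the total energy bounds \<open>f K\<close> for every
  compact \<open>K\<close> in a ball of radius \<open>R\<close>, up to a factor \<open>(R + 1) powr (d / 2)\<close>. It remains to choose \<open>T\<close>
  (and, for mixtures, \<open>R = T\<close> of order \<open>sqrt (ln (1 / TV))\<close>). All Plancherel steps are
  inequalities with an extra Gaussian factor, so no inversion theorem is needed.
\<close>

section \<open>Gaussian kernels and their Fourier transforms\<close>

text \<open>Cauchy--Schwarz puts TV squared on the left, so the low-frequency energy has to be
  quadratic in \<open>D\<close>. The sup bound on the profile gives one factor \<open>D\<close>, and
  \<open>W\<close> gives the other: a profile living essentially on \<open>[-R, R]\<close> has
  \<open>L^1\<close> norm about \<open>2 * R * D\<close>. Here compact support or Gaussian tails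
  enter a first time; they enter again when \<open>R\<close> bounds the region on which sets are
  tested.

  Write \<open>d\<close> for the dimension. In \<open>T ^ (d + 1)\<close>, dilating the unit ball
  gives \<open>T ^ d\<close>, the factor \<open>t\<close> between profile and \<open>f\<close> gives
  \<open>T ^ 2\<close>, and averaging over a window of length \<open>T\<close> removes one power.
  Part (i) balances \<open>T ^ (d + 1) * D ^ 2\<close> against \<open>T powr (- 2 * \<beta>)\<close>
  times the Sobolev energies. In part (ii) the volume \<open>R ^ d\<close>, the energy
  \<open>R ^ (d + 1)\<close> and the profile width \<open>R\<close> multiply to
  \<open>R ^ (2 * (d + 1))\<close>; its square root is the power \<open>(d + 1) / 2\<close> of the
  logarithm.

  The transform of a law is a priori only bounded, so the Gaussian factor is what justifies Fubini.
  The corresponding kernel has mass one, so the bounds do not depend on its width.\<close>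

definition ft :: "'a::euclidean_space measure \<Rightarrow> ('a \<Rightarrow> real) \<Rightarrow> 'a \<Rightarrow> complex" where
  "ft M f \<omega> = (LINT x|M. exp (- \<i> * of_real (x \<bullet> \<omega>)) * of_real (f x))"

text \<open>The density of N(0, s^2 I). Being a product over coordinates rather than a function of
  \<open>norm z\<close>, it reduces mass and Fourier transform to the one-dimensional normal law;
  \<open>gauss_kernel_1_eq\<close> supplies the radial form.\<close>

definition gauss_kernel :: "real \<Rightarrow> 'a::euclidean_space \<Rightarrow> real" where
  "gauss_kernel s z = (\<Prod>b\<in>Basis. normal_density 0 s (z \<bullet> b))"

lemma cmod_exp_neg_ii [simp]: "cmod (exp (- (\<i> * of_real t))) = 1"
  by (metis mult_minus_right norm_exp_i_times of_real_minus)

lemma gauss_kernel_measurable [measurable]: "gauss_kernel s \<in> borel_measurable borel"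
  unfolding gauss_kernel_def[abs_def] by measurable

lemma gauss_kernel_nonneg: "0 \<le> gauss_kernel s z"
  unfolding gauss_kernel_def by (intro prod_nonneg) (auto simp: normal_density_nonneg)

lemma nn_integral_gauss_kernel:
  assumes "s > 0"
  shows "(\<integral>\<^sup>+z. ennreal (gauss_kernel s z) \<partial>(lborel::'a::euclidean_space measure)) = 1"
proof -
  have "(\<integral>\<^sup>+z. ennreal (gauss_kernel s z) \<partial>(lborel::'a measure)) =
      (\<integral>\<^sup>+z. (\<Prod>b\<in>Basis. ennreal (normal_density 0 s (z \<bullet> b))) \<partial>(lborel::'a measure))"
    unfolding gauss_kernel_def by (simp add: prod_ennreal normal_density_nonneg)
  also have "\<dots> = (\<Prod>b\<in>(Basis::'a set). \<integral>\<^sup>+x. ennreal (normal_density 0 s x) \<partial>lborel)"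
    by (subst nn_integral_lborel_prod) (auto simp: normal_density_nonneg)
  also have "(\<integral>\<^sup>+x. ennreal (normal_density 0 s x) \<partial>lborel) = 1"
    using assms by (simp add: nn_integral_eq_integral normal_density_nonneg integrable_normal_density
        integral_normal_density)
  finally show ?thesis by simp
qed

lemma integrable_gauss_kernel:
  assumes "s > 0"
  shows "integrable lborel (gauss_kernel s :: 'a::euclidean_space \<Rightarrow> real)"
  using nn_integral_gauss_kernel[OF assms, where 'a='a]
  by (intro integrableI_nonneg) (auto simp: gauss_kernel_nonneg)

lemma integral_gauss_kernel:
  assumes "s > 0"
  shows "(LINT z|(lborel::'a::euclidean_space measure). gauss_kernel s z) = 1"
  using nn_integral_gauss_kernel[OF assms, where 'a='a]
  by (intro integral_eq_nn_integral[THEN trans]) (auto simp: gauss_kernel_nonneg)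

text \<open>Substitute \<open>x = s * u\<close> in the characteristic function of the standard
  normal law at \<open>- (z / s)\<close>. Writing the value as a multiple of a normal density makes
  the product over coordinates a multiple of \<open>gauss_kernel s\<close>, an approximate identity
  as \<open>s\<close> tends to 0.\<close>

lemma fourier_gaussian_real:
  fixes s z :: real
  assumes s: "s > 0"
  shows "integrable lborel (\<lambda>u. exp (- \<i> * of_real (u * z)) * of_real (exp (- (s * u)\<^sup>2 / 2)))"
    and "(LINT u|lborel. exp (- \<i> * of_real (u * z)) * of_real (exp (- (s * u)\<^sup>2 / 2)))
      = of_real (2 * pi * normal_density 0 s z)"
proof -
  have int: "integrable lborel (\<lambda>x::real. exp (- x\<^sup>2 / 2))"
  proof -
    have "(\<lambda>x::real. exp (- x\<^sup>2 / 2)) = (\<lambda>x. sqrt (2 * pi) * std_normal_density x)"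
      by (auto simp: std_normal_density_def)
    then show ?thesis
      by (simp only:) (intro integrable_mult_right integrable_normal_density; simp)
  qed
  have "integrable lborel (\<lambda>u. exp (- (0 + s * u)\<^sup>2 / 2))"
    using int s by (intro lborel_integrable_real_affine) auto
  then show "integrable lborel (\<lambda>u. exp (- \<i> * of_real (u * z)) * of_real (exp (- (s * u)\<^sup>2 / 2)))"
    by (rule Bochner_Integration.integrable_bound) (auto simp: norm_mult)
  have "of_real (exp (- (z / s)\<^sup>2 / 2)) = char std_normal_distribution (- (z / s))"
    by (simp add: char_std_normal_distribution)
  also have "\<dots> = (LINT x|lborel. std_normal_density x *\<^sub>R iexp (- (z / s) * x))"
    unfolding char_def by (subst integral_density) (auto simp: normal_density_nonneg)
  also have "\<dots> = s *\<^sub>R (LINT x|lborel. std_normal_density (0 + s * x) *\<^sub>R iexp (- (z / s) * (0 + s * x)))"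
    using s by (subst lborel_integral_real_affine[of s _ 0]) auto
  also have "(\<lambda>x. std_normal_density (0 + s * x) *\<^sub>R iexp (- (z / s) * (0 + s * x))) =
     (\<lambda>u. of_real (1 / sqrt (2 * pi)) * (exp (- \<i> * of_real (u * z)) * of_real (exp (- (s * u)\<^sup>2 / 2))))"
    using s by (auto simp: std_normal_density_def scaleR_conv_of_real mult_ac)
  also have "(LINT u|lborel. of_real (1 / sqrt (2 * pi)) * (exp (- \<i> * of_real (u * z)) * of_real (exp (- (s * u)\<^sup>2 / 2))))
     = of_real (1 / sqrt (2 * pi)) * (LINT u|lborel. exp (- \<i> * of_real (u * z)) * of_real (exp (- (s * u)\<^sup>2 / 2)))"
    (is "_ = _ * ?I") by (rule integral_mult_right_zero)
  finally have eq: "complex_of_real (exp (- (z / s)\<^sup>2 / 2)) = of_real s * (of_real (1 / sqrt (2 * pi)) * ?I)"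
    by (simp only: scaleR_conv_of_real)
  have nz: "complex_of_real s \<noteq> 0" "complex_of_real (sqrt (2 * pi)) \<noteq> 0" using s by auto
  have "?I = of_real (sqrt (2 * pi)) / of_real s * (of_real s * (of_real (1 / sqrt (2 * pi)) * ?I))"
    using nz by (simp add: field_simps del: of_real_mult real_sqrt_mult of_real_sqrt)
  also have "\<dots> = of_real (sqrt (2 * pi) / s * exp (- (z / s)\<^sup>2 / 2))"
    using eq by simp
  also have "sqrt (2 * pi) / s * exp (- (z / s)\<^sup>2 / 2) = 2 * pi * normal_density 0 s z"
  proof -
    have sq: "sqrt (2 * pi * s\<^sup>2) = sqrt (2 * pi) * s"
      using s by (simp add: real_sqrt_mult)
    have "2 * pi = sqrt (2 * pi) * sqrt (2 * pi)" by simp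
    then have c: "2 * pi * (1 / sqrt (2 * pi * s\<^sup>2)) = sqrt (2 * pi) / s"
      unfolding sq using s by (simp add: field_simps del: real_sqrt_mult real_sqrt_mult_self)
    have "2 * pi * normal_density 0 s z = 2 * pi * (1 / sqrt (2 * pi * s\<^sup>2)) * exp (- (z / s)\<^sup>2 / 2)"
      by (simp add: normal_density_def power_divide mult.commute)
    then show ?thesis unfolding c by simp
  qed
  finally show "?I = of_real (2 * pi * normal_density 0 s z)" .
qed

text \<open>Squared norm and inner product are sums over the basis, so the integrand is a product of
  one-dimensional ones, and \<open>lborel_eq\<close> turns the integral into one over a product
  measure.\<close>

lemma fourier_gaussian:
  fixes z :: "'a::euclidean_space"
  assumes s: "s > 0"
  shows "integrable lborel (\<lambda>u::'a. exp (- (s * norm u)\<^sup>2 / 2))"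
    and "ft lborel (\<lambda>u. exp (- (s * norm u)\<^sup>2 / 2)) z = of_real ((2 * pi) ^ DIM('a) * gauss_kernel s z)"
proof -
  interpret P: product_sigma_finite "\<lambda>_::'a. lborel::real measure" ..
  let ?f = "\<lambda>z (b::'a) t. exp (- \<i> * of_real (t * (z \<bullet> b))) * complex_of_real (exp (- (s * t)\<^sup>2 / 2))"
  have eq: "exp (- \<i> * of_real (u \<bullet> z)) * of_real (exp (- (s * norm u)\<^sup>2 / 2)) = (\<Prod>b\<in>Basis. ?f z b (u \<bullet> b))"
    for u z :: 'a
  proof -
    have n: "(s * norm u)\<^sup>2 = (\<Sum>b\<in>Basis. (s * (u \<bullet> b))\<^sup>2)"
      by (simp add: power_mult_distrib sum_distrib_left[symmetric] power2_norm_eq_inner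
          euclidean_inner[of u u]) (simp add: power2_eq_square)
    have "- (s * norm u)\<^sup>2 / 2 = (\<Sum>b\<in>Basis. - (s * (u \<bullet> b))\<^sup>2 / 2)"
      unfolding n by (simp add: sum_negf sum_divide_distrib)
    moreover have "- \<i> * of_real (u \<bullet> z) = (\<Sum>b\<in>Basis. - \<i> * of_real ((u \<bullet> b) * (z \<bullet> b)))"
      by (subst euclidean_inner[of u z]) (simp add: sum_distrib_left sum_negf)
    ultimately show ?thesis
      by (simp only: exp_sum[OF finite_Basis] prod.distrib of_real_prod)
  qed
  have repr: "(\<Sum>c\<in>Basis. g c *\<^sub>R c) \<bullet> b = g b" if "b \<in> Basis" for g and b :: 'a
    using that by (simp add: inner_sum_left inner_Basis if_distrib cong: if_cong)
  have int0: "integrable lborel (?f z b)" for z and b :: 'a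
    using fourier_gaussian_real(1)[OF s] by simp
  have I: "integrable (Pi\<^sub>M Basis (\<lambda>_. lborel)) (\<lambda>g. \<Prod>b\<in>Basis. ?f z b (g b))" for z :: 'a
    by (intro P.product_integrable_prod finite_Basis int0)
  have meas: "(\<lambda>f. \<Sum>b\<in>Basis. f b *\<^sub>R (b::'a)) \<in> Pi\<^sub>M Basis (\<lambda>_. lborel) \<rightarrow>\<^sub>M borel"
    by measurable
  have I2: "integrable lborel (\<lambda>u. \<Prod>b\<in>Basis. ?f z b (u \<bullet> b))" for z :: 'a
    unfolding lborel_eq[where 'a='a]
    using I[of z] by (subst integrable_distr_eq[OF meas]) (simp_all add: repr cong: prod.cong)
  \<comment> \<open>All phases equal 1 at \<open>z = 0\<close>, so this norm is the Gaussian
    itself.\<close>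
  have "integrable lborel (\<lambda>u::'a. norm (\<Prod>b\<in>Basis. ?f 0 b (u \<bullet> b)))"
    using I2[of 0] by (rule integrable_norm)
  then show "integrable lborel (\<lambda>u::'a. exp (- (s * norm u)\<^sup>2 / 2))"
    unfolding eq[of _ 0, symmetric] by (simp add: norm_mult)
  have "ft lborel (\<lambda>u. exp (- (s * norm u)\<^sup>2 / 2)) z = (LINT u|lborel. (\<Prod>b\<in>Basis. ?f z b (u \<bullet> b)))"
    unfolding ft_def eq ..
  also have "\<dots> = (LINT g|Pi\<^sub>M Basis (\<lambda>_. lborel). (\<Prod>b\<in>Basis. ?f z b (g b)))"
    unfolding lborel_eq[where 'a='a]
    by (subst integral_distr[OF meas]) (auto simp: repr cong: prod.cong)
  also have "\<dots> = (\<Prod>b\<in>Basis. (LINT t|lborel. ?f z b t))"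
    by (intro P.product_integral_prod finite_Basis int0)
  also have "\<dots> = (\<Prod>b\<in>Basis. of_real (2 * pi * normal_density 0 s (z \<bullet> b)))"
    using fourier_gaussian_real(2)[OF s] by simp
  also have "\<dots> = of_real ((2 * pi) ^ DIM('a) * gauss_kernel s z)"
    by (simp add: gauss_kernel_def prod.distrib)
  finally show "ft lborel (\<lambda>u. exp (- (s * norm u)\<^sup>2 / 2)) z = \<dots>" .
qed

section \<open>Parseval and Plancherel with Gaussian damping\<close>

lemma integrable_pair_mult:
  fixes a b :: "'a::euclidean_space \<Rightarrow> 'b::{real_normed_field, banach, second_countable_topology}"
  assumes "pair_sigma_finite M N" "integrable M a" "integrable N b"
  shows "integrable (M \<Otimes>\<^sub>M N) (\<lambda>p. a (fst p) * b (snd p))"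
proof -
  interpret pair_sigma_finite M N by fact
  have [measurable]: "a \<in> borel_measurable M" "b \<in> borel_measurable N"
    using assms by auto
  have "integrable (M \<Otimes>\<^sub>M N) (\<lambda>(x, y). a x * b y)"
  proof (rule Fubini_integrable)
    show "integrable M (\<lambda>x. LINT y|N. norm (case (x, y) of (x, y) \<Rightarrow> a x * b y))"
      using assms(2) by (simp add: norm_mult)
    show "AE x in M. integrable N (\<lambda>y. case (x, y) of (x, y) \<Rightarrow> a x * b y)"
      using assms(3) by simp
  qed simp
  then show ?thesis by (simp add: case_prod_unfold)
qed

lemma integrable_ft:
  fixes \<omega> :: "'a::euclidean_space"
  assumes [measurable_cong]: "sets M = sets borel" and a: "integrable M a"
  shows "integrable M (\<lambda>x. exp (- \<i> * of_real (x \<bullet> \<omega>)) * of_real (a x))"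
proof -
  have [measurable]: "a \<in> borel_measurable M"
    using a by auto
  show ?thesis
  proof (rule Bochner_Integration.integrable_bound[OF a])
    show "(\<lambda>x. exp (- \<i> * of_real (x \<bullet> \<omega>)) * complex_of_real (a x)) \<in> borel_measurable M"
      by measurable
  qed (auto simp: norm_mult)
qed

lemma ft_measurable:
  assumes "sigma_finite_measure M" and [measurable_cong]: "sets M = sets borel"
    and [measurable]: "a \<in> borel_measurable borel"
  shows "ft M a \<in> borel_measurable borel"
proof -
  interpret sigma_finite_measure M by fact
  show ?thesis unfolding ft_def[abs_def] by measurable
qed

lemma norm_ft_le:
  assumes "sets M = sets borel" "integrable M a"
  shows "norm (ft M a \<omega>) \<le> (LINT x|M. \<bar>a x\<bar>)"
proof -
  have "norm (ft M a \<omega>) \<le> (LINT x|M. norm (exp (- \<i> * of_real (x \<bullet> \<omega>)) * complex_of_real (a x)))"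
    unfolding ft_def by (rule integral_norm_bound)
  then show ?thesis by (simp add: norm_mult)
qed

text \<open>Damped Parseval formula: represent the kernel as the transform of a Gaussian in
  \<open>\<omega>\<close> and exchange the integrals; that Gaussian makes the triple integrand
  absolutely integrable. Two weighted measures are allowed because the lemma is used both with
  Lebesgue measure on each side, for Plancherel, and with a law on one side and a test function on
  the other.\<close>

lemma integral_gauss_kernel_pair:
  fixes M N :: "'a::euclidean_space measure"
  assumes s: "s > 0" and M: "sigma_finite_measure M" "sets M = sets borel" "integrable M a"
    and N: "sigma_finite_measure N" "sets N = sets borel" "integrable N b"
  shows "integrable (M \<Otimes>\<^sub>M N) (\<lambda>p. a (fst p) * b (snd p) * gauss_kernel s (fst p - snd p))"
    and "of_real ((2 * pi) ^ DIM('a) *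
        (LINT p|(M \<Otimes>\<^sub>M N). a (fst p) * b (snd p) * gauss_kernel s (fst p - snd p)))
      = (LINT \<omega>|lborel. ft M a \<omega> * cnj (ft N b \<omega>) * of_real (exp (- (s * norm \<omega>)\<^sup>2 / 2)))"
proof -
  interpret M: sigma_finite_measure M by fact
  interpret N: sigma_finite_measure N by fact
  interpret MN: pair_sigma_finite M N ..
  interpret L: pair_sigma_finite "M \<Otimes>\<^sub>M N" "lborel::'a measure" ..
  note [measurable_cong] = M(2) N(2)
  have [measurable]: "a \<in> borel_measurable M" "b \<in> borel_measurable N" using M N by auto
  let ?G = "\<lambda>\<omega>::'a. exp (- (s * norm \<omega>)\<^sup>2 / 2)"
  let ?H = "\<lambda>p \<omega>. exp (- \<i> * of_real ((fst p - snd p) \<bullet> \<omega>)) * complex_of_real (a (fst p) * b (snd p)) * of_real (?G \<omega>)"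
  have I1: "integrable (M \<Otimes>\<^sub>M N) (\<lambda>p. a (fst p) * b (snd p))"
    by (intro integrable_pair_mult M N) unfold_locales
  have I2: "integrable ((M \<Otimes>\<^sub>M N) \<Otimes>\<^sub>M lborel) (\<lambda>q. ?H (fst q) (snd q))"
  proof (rule Bochner_Integration.integrable_bound)
    have "integrable ((M \<Otimes>\<^sub>M N) \<Otimes>\<^sub>M lborel) (\<lambda>(p, \<omega>). (a (fst p) * b (snd p)) * ?G \<omega>)"
    proof (rule L.Fubini_integrable)
      show "integrable (M \<Otimes>\<^sub>M N) (\<lambda>p. LINT \<omega>|lborel. norm (case (p, \<omega>) of (p, \<omega>) \<Rightarrow> a (fst p) * b (snd p) * ?G \<omega>))"
        using integrable_abs[OF I1] by (simp add: abs_mult)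
      show "AE p in M \<Otimes>\<^sub>M N. integrable lborel (\<lambda>\<omega>. case (p, \<omega>) of (p, \<omega>) \<Rightarrow> a (fst p) * b (snd p) * ?G \<omega>)"
        using fourier_gaussian(1)[OF s, where 'a='a] by simp
    qed measurable
    then show "integrable ((M \<Otimes>\<^sub>M N) \<Otimes>\<^sub>M lborel) (\<lambda>q. (a (fst (fst q)) * b (snd (fst q))) * ?G (snd q))"
      by (simp add: case_prod_unfold)
    show "(\<lambda>q. ?H (fst q) (snd q)) \<in> borel_measurable ((M \<Otimes>\<^sub>M N) \<Otimes>\<^sub>M lborel)"
      by measurable
  qed (auto simp: norm_mult abs_mult)
  have inner1: "(LINT \<omega>|lborel. ?H p \<omega>) = of_real ((2 * pi) ^ DIM('a) * (a (fst p) * b (snd p) * gauss_kernel s (fst p - snd p)))" for p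
  proof -
    have "(LINT \<omega>|lborel. ?H p \<omega>) = of_real (a (fst p) * b (snd p)) * ft lborel ?G (fst p - snd p)"
      unfolding ft_def by (subst integral_mult_right_zero[symmetric])
        (intro Bochner_Integration.integral_cong refl, simp add: inner_commute mult_ac)
    then show ?thesis unfolding fourier_gaussian(2)[OF s] by simp
  qed
  have inner2: "(LINT p|(M \<Otimes>\<^sub>M N). ?H p \<omega>) = ft M a \<omega> * cnj (ft N b \<omega>) * of_real (?G \<omega>)" for \<omega>
  proof -
    let ?f = "\<lambda>x. exp (- \<i> * of_real (x \<bullet> \<omega>)) * of_real (a x)"
    let ?g = "\<lambda>x. cnj (exp (- \<i> * of_real (x \<bullet> \<omega>)) * of_real (b x))"
    have If: "integrable M ?f" by (rule integrable_ft[OF M(2,3)])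
    have Ig: "integrable N ?g" using integrable_ft[OF N(2,3)] by (simp only: integrable_cnj)
    have "(LINT p|(M \<Otimes>\<^sub>M N). ?H p \<omega>) = (LINT p|(M \<Otimes>\<^sub>M N). ?f (fst p) * ?g (snd p)) * of_real (?G \<omega>)"
    proof (subst integral_mult_left_zero[symmetric], intro Bochner_Integration.integral_cong refl)
      fix p
      have "exp (- \<i> * of_real ((fst p - snd p) \<bullet> \<omega>)) =
         exp (- \<i> * of_real (fst p \<bullet> \<omega>)) * cnj (exp (- \<i> * of_real (snd p \<bullet> \<omega>)))"
        by (simp add: exp_cnj exp_add[symmetric] inner_diff_left algebra_simps)
      then show "?H p \<omega> = ?f (fst p) * ?g (snd p) * of_real (?G \<omega>)"
        by (simp add: mult_ac)
    qed
    also have "(LINT p|(M \<Otimes>\<^sub>M N). ?f (fst p) * ?g (snd p)) = (LINT x|M. LINT y|N. ?f x * ?g y)"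
      using MN.integral_fst[of "\<lambda>x y. ?f x * ?g y"] integrable_pair_mult[OF MN.pair_sigma_finite_axioms If Ig]
      by (simp only: case_prod_unfold)
    also have "\<dots> = (LINT x|M. ?f x) * (LINT y|N. ?g y)"
      by (simp only: integral_mult_right_zero integral_mult_left_zero)
    also have "(LINT y|N. ?g y) = cnj (ft N b \<omega>)"
      unfolding ft_def by (simp only: Bochner_Integration.integral_cnj)
    finally show ?thesis unfolding ft_def .
  qed
  \<comment> \<open>Integrability on the kernel side also comes from Fubini: by
    \<open>inner1\<close> the inner integral over \<open>\<omega>\<close> is a positive multiple of
    that integrand.\<close>
  have "integrable (M \<Otimes>\<^sub>M N) (\<lambda>p. LINT \<omega>|lborel. ?H p \<omega>)"
    using L.integrable_fst'[OF I2] by (simp only: fst_conv snd_conv)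
  then have "integrable (M \<Otimes>\<^sub>M N) (\<lambda>p. Re (LINT \<omega>|lborel. ?H p \<omega>))"
    by (rule integrable_Re)
  then have "integrable (M \<Otimes>\<^sub>M N) (\<lambda>p. (2 * pi) ^ DIM('a) * (a (fst p) * b (snd p) * gauss_kernel s (fst p - snd p)))"
    unfolding inner1 by simp
  then show "integrable (M \<Otimes>\<^sub>M N) (\<lambda>p. a (fst p) * b (snd p) * gauss_kernel s (fst p - snd p))"
    by simp
  have "(LINT \<omega>|lborel. ft M a \<omega> * cnj (ft N b \<omega>) * of_real (?G \<omega>)) = (LINT \<omega>|lborel. LINT p|(M \<Otimes>\<^sub>M N). ?H p \<omega>)"
    by (simp only: inner2)
  also have "\<dots> = (LINT p|(M \<Otimes>\<^sub>M N). LINT \<omega>|lborel. ?H p \<omega>)"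
    using L.Fubini_integral[of ?H] I2 by (simp only: case_prod_unfold)
  also have "\<dots> = of_real ((2 * pi) ^ DIM('a) *
        (LINT p|(M \<Otimes>\<^sub>M N). a (fst p) * b (snd p) * gauss_kernel s (fst p - snd p)))"
    unfolding inner1 by (simp only: integral_complex_of_real integral_mult_right_zero)
  finally show "of_real ((2 * pi) ^ DIM('a) *
        (LINT p|(M \<Otimes>\<^sub>M N). a (fst p) * b (snd p) * gauss_kernel s (fst p - snd p))) =
        (LINT \<omega>|lborel. ft M a \<omega> * cnj (ft N b \<omega>) * of_real (?G \<omega>))" ..
qed

lemma distr_lborel_diff:
  fixes x :: "'a::euclidean_space"
  shows "distr lborel borel (\<lambda>y. x - y) = lborel"
  using lborel_affine[of "-1" x] by (simp add: density_1)

text \<open>With Lebesgue measure on both sides, integrating \<open>\<phi> y\<close> against a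
  kernel of mass one gives at most \<open>B\<close>, and the remaining integral is the
  \<open>L^1\<close> norm. This form is preferred to the \<open>L^2\<close> norm because for a
  half-space profile the sup and the \<open>L^1\<close> norm are controlled separately.\<close>

lemma plancherel_gauss_le:
  fixes \<phi> :: "'a::euclidean_space \<Rightarrow> real"
  assumes s: "s > 0" and \<phi>: "integrable lborel \<phi>" and B: "\<And>x. \<bar>\<phi> x\<bar> \<le> B"
  shows "integrable lborel (\<lambda>\<omega>. (cmod (ft lborel \<phi> \<omega>))\<^sup>2 * exp (- (s * norm \<omega>)\<^sup>2 / 2))"
    and "(LINT \<omega>|lborel. (cmod (ft lborel \<phi> \<omega>))\<^sup>2 * exp (- (s * norm \<omega>)\<^sup>2 / 2))
      \<le> (2 * pi) ^ DIM('a) * (B * (LINT x|lborel. \<bar>\<phi> x\<bar>))"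
proof -
  have [measurable]: "\<phi> \<in> borel_measurable borel" using \<phi> by auto
  have [measurable]: "ft lborel \<phi> \<in> borel_measurable borel"
    by (intro ft_measurable) (auto intro: lborel.sigma_finite_measure_axioms)
  have B0: "0 \<le> B" using B[of 0] by (meson abs_ge_zero order_trans)
  let ?G = "\<lambda>\<omega>::'a. exp (- (s * norm \<omega>)\<^sup>2 / 2)"
  let ?l = "LINT x|lborel. \<bar>\<phi> x\<bar>"
  show "integrable lborel (\<lambda>\<omega>. (cmod (ft lborel \<phi> \<omega>))\<^sup>2 * ?G \<omega>)"
  proof (rule Bochner_Integration.integrable_bound)
    show "integrable lborel (\<lambda>\<omega>. ?l\<^sup>2 * ?G \<omega>)"
      using fourier_gaussian(1)[OF s, where 'a='a] by simp
    show "AE \<omega> in lborel. norm ((cmod (ft lborel \<phi> \<omega>))\<^sup>2 * ?G \<omega>) \<le> norm (?l\<^sup>2 * ?G \<omega>)"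
      by (rule AE_I2) (auto intro!: mult_right_mono power_mono norm_ft_le \<phi>)
  qed simp
  have cc: "ft lborel \<phi> \<omega> * cnj (ft lborel \<phi> \<omega>) = of_real ((cmod (ft lborel \<phi> \<omega>))\<^sup>2)" for \<omega>
    by (simp only: complex_norm_square)
  have I: "integrable (lborel \<Otimes>\<^sub>M lborel) (\<lambda>p. \<phi> (fst p) * \<phi> (snd p) * gauss_kernel s (fst p - snd p))"
    by (rule integral_gauss_kernel_pair(1)[OF s]) (auto intro: lborel.sigma_finite_measure_axioms \<phi>)
  have "complex_of_real (LINT \<omega>|lborel. (cmod (ft lborel \<phi> \<omega>))\<^sup>2 * ?G \<omega>) =
     of_real ((2 * pi) ^ DIM('a) *
        (LINT p|(lborel \<Otimes>\<^sub>M lborel). \<phi> (fst p) * \<phi> (snd p) * gauss_kernel s (fst p - snd p)))"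
    by (subst integral_gauss_kernel_pair(2)[OF s])
      (auto intro: lborel.sigma_finite_measure_axioms \<phi> simp: cc integral_complex_of_real[symmetric] simp del: integral_complex_of_real)
  then have "(LINT \<omega>|lborel. (cmod (ft lborel \<phi> \<omega>))\<^sup>2 * ?G \<omega>) =
     (2 * pi) ^ DIM('a) *
        (LINT p|(lborel \<Otimes>\<^sub>M lborel). \<phi> (fst p) * \<phi> (snd p) * gauss_kernel s (fst p - snd p))"
    by (simp only: of_real_eq_iff)
  also have "(LINT p|(lborel \<Otimes>\<^sub>M lborel). \<phi> (fst p) * \<phi> (snd p) * gauss_kernel s (fst p - snd p))
     = (LINT x|lborel. LINT y|lborel. \<phi> x * \<phi> y * gauss_kernel s (x - y))"
    using lborel_pair.integral_fst[of "\<lambda>x y. \<phi> x * \<phi> y * gauss_kernel s (x - y)"] I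
    by (simp add: case_prod_unfold)
  also have "\<dots> \<le> (LINT x|lborel. \<bar>\<phi> x\<bar> * B)"
  proof (rule integral_mono)
    show "integrable lborel (\<lambda>x. LINT y|lborel. \<phi> x * \<phi> y * gauss_kernel s (x - y))"
      using lborel_pair.integrable_fst'[OF I] by simp
    show "integrable lborel (\<lambda>x. \<bar>\<phi> x\<bar> * B)" using \<phi> by simp
    fix x :: 'a
    have k: "integrable lborel (\<lambda>y. gauss_kernel s (x - y))"
      using integrable_gauss_kernel[OF s, where 'a='a] integrable_distr_eq[of "\<lambda>y. x - y" lborel borel "gauss_kernel s"]
      by (simp add: distr_lborel_diff)
    have k1: "(LINT y|lborel. gauss_kernel s (x - y)) = 1"
      using integral_gauss_kernel[OF s, where 'a='a] integral_distr[of "\<lambda>y. x - y" lborel borel "gauss_kernel s"]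
      by (simp add: distr_lborel_diff)
    have "(LINT y|lborel. \<phi> x * \<phi> y * gauss_kernel s (x - y)) = \<phi> x * (LINT y|lborel. \<phi> y * gauss_kernel s (x - y))"
      by (simp add: mult.assoc)
    also have "\<dots> \<le> \<bar>\<phi> x\<bar> * \<bar>LINT y|lborel. \<phi> y * gauss_kernel s (x - y)\<bar>"
      by (metis abs_ge_self abs_mult)
    also have "\<bar>LINT y|lborel. \<phi> y * gauss_kernel s (x - y)\<bar> \<le> (LINT y|lborel. B * gauss_kernel s (x - y))"
    proof (rule integral_abs_bound[THEN order_trans], rule integral_mono')
      show "integrable lborel (\<lambda>y. B * gauss_kernel s (x - y))" using k by simp
    qed (auto simp: abs_mult gauss_kernel_nonneg B B0 intro!: mult_right_mono mult_nonneg_nonneg)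
    also have "\<dots> = B" using k1 by simp
    finally show "(LINT y|lborel. \<phi> x * \<phi> y * gauss_kernel s (x - y)) \<le> \<bar>\<phi> x\<bar> * B"
      by (simp add: mult_left_mono)
  qed
  also have "\<dots> = B * ?l" by simp
  finally show "(LINT \<omega>|lborel. (cmod (ft lborel \<phi> \<omega>))\<^sup>2 * ?G \<omega>) \<le> (2 * pi) ^ DIM('a) * (B * ?l)"
    by simp
qed

section \<open>From Fourier transforms to compact sets\<close>

lemma gauss_kernel_scaleR:
  fixes z :: "'a::euclidean_space"
  assumes "s > 0"
  shows "s ^ DIM('a) * gauss_kernel s (s *\<^sub>R z) = gauss_kernel 1 z"
proof -
  have "normal_density 0 s (s * t) * s = normal_density 0 1 t" for t
    using assms by (simp add: normal_density_def real_sqrt_mult power_mult_distrib)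
  then have "(\<Prod>b\<in>(Basis::'a set). normal_density 0 s (s * (z \<bullet> b)) * s) = gauss_kernel 1 z"
    unfolding gauss_kernel_def by simp
  then show ?thesis unfolding gauss_kernel_def by (simp add: prod.distrib mult.commute)
qed

text \<open>The substitution \<open>y = x - s *\<^sub>R z\<close> moves \<open>s\<close> from the
  kernel into the argument of \<open>\<phi>\<close>, so that for bounded \<open>\<phi>\<close> one
  integrable function dominates for all \<open>s\<close>.\<close>

lemma integral_gauss_kernel_shift:
  fixes \<phi> :: "'a::euclidean_space \<Rightarrow> real"
  assumes s: "s > 0" and [measurable]: "\<phi> \<in> borel_measurable borel"
  shows "(LINT y|lborel. \<phi> y * gauss_kernel s (x - y)) = (LINT z|lborel. \<phi> (x - s *\<^sub>R z) * gauss_kernel 1 z)"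
proof -
  have "(LINT y|lborel. \<phi> y * gauss_kernel s (x - y)) =
     (LINT z|lborel. s ^ DIM('a) * (\<phi> (x - s *\<^sub>R z) * gauss_kernel s (s *\<^sub>R z)))"
    using s by (subst lborel_affine[of "- s" x])
      (auto simp: integral_density integral_distr power_abs[symmetric])
  also have "\<dots> = (LINT z|lborel. \<phi> (x - s *\<^sub>R z) * gauss_kernel 1 z)"
    by (intro Bochner_Integration.integral_cong refl) (simp add: gauss_kernel_scaleR[OF s, symmetric])
  finally show ?thesis .
qed

text \<open>Dominated convergence twice: in \<open>z\<close> under
  \<open>B * gauss_kernel 1 z\<close>, where continuity of \<open>\<phi>\<close> gives the pointwise
  limit, then in \<open>x\<close> under the constant \<open>B\<close>, integrable because
  \<open>M\<close> is finite.\<close>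

lemma gauss_kernel_approx_identity:
  fixes \<phi> :: "'a::euclidean_space \<Rightarrow> real"
  assumes M: "finite_measure M" and [measurable_cong]: "sets M = sets borel"
    and cont: "continuous_on UNIV \<phi>" and B: "\<And>x. \<bar>\<phi> x\<bar> \<le> B" and \<phi>: "integrable lborel \<phi>"
  shows "(\<lambda>n. LINT p|(M \<Otimes>\<^sub>M lborel). \<phi> (snd p) * gauss_kernel (1 / Suc n) (fst p - snd p))
    \<longlonglongrightarrow> (LINT x|M. \<phi> x)"
proof -
  interpret M: finite_measure M by fact
  interpret P: pair_sigma_finite M "lborel::'a measure" ..
  have [measurable]: "\<phi> \<in> borel_measurable borel"
    using cont by (rule borel_measurable_continuous_onI)
  let ?u = "\<lambda>n x. LINT z|lborel. \<phi> (x - (1 / Suc n) *\<^sub>R z) * gauss_kernel 1 z"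
  have eq: "(LINT p|(M \<Otimes>\<^sub>M lborel). \<phi> (snd p) * gauss_kernel (1 / Suc n) (fst p - snd p)) = (LINT x|M. ?u n x)" for n
  proof -
    have I: "integrable (M \<Otimes>\<^sub>M lborel) (\<lambda>p. 1 * \<phi> (snd p) * gauss_kernel (1 / Suc n) (fst p - snd p))"
      using assms by (intro integral_gauss_kernel_pair(1))
        (auto intro: lborel.sigma_finite_measure_axioms M.sigma_finite_measure_axioms)
    have "(LINT p|(M \<Otimes>\<^sub>M lborel). \<phi> (snd p) * gauss_kernel (1 / Suc n) (fst p - snd p))
       = (LINT x|M. LINT y|lborel. \<phi> y * gauss_kernel (1 / Suc n) (x - y))"
      using P.integral_fst[of "\<lambda>x y. \<phi> y * gauss_kernel (1 / Suc n) (x - y)"] I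
      by (simp add: case_prod_unfold)
    then show ?thesis by (subst (asm) integral_gauss_kernel_shift) auto
  qed
  have k: "integrable lborel (gauss_kernel 1 :: 'a \<Rightarrow> real)" "(LINT z|(lborel::'a measure). gauss_kernel 1 z) = 1"
    using integrable_gauss_kernel[of 1] integral_gauss_kernel[of 1] by auto
  have bound: "\<bar>\<phi> y * gauss_kernel 1 z\<bar> \<le> B * gauss_kernel 1 z" for y z :: 'a
    by (auto simp: abs_mult gauss_kernel_nonneg B intro!: mult_right_mono)
  have "(\<lambda>n. LINT x|M. ?u n x) \<longlonglongrightarrow> (LINT x|M. \<phi> x)"
  proof (rule integral_dominated_convergence[where w="\<lambda>_. B"])
    show "AE x in M. (\<lambda>n. ?u n x) \<longlonglongrightarrow> \<phi> x"
    proof (rule AE_I2)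
      fix x
      have "(\<lambda>n. ?u n x) \<longlonglongrightarrow> (LINT z|(lborel::'a measure). \<phi> x * gauss_kernel 1 z)"
      proof (rule integral_dominated_convergence[where w="\<lambda>z::'a. B * gauss_kernel 1 z"])
        show "AE z in lborel. (\<lambda>n. \<phi> (x - (1 / Suc n) *\<^sub>R z) * gauss_kernel 1 z) \<longlonglongrightarrow> \<phi> x * gauss_kernel 1 z"
        proof (rule AE_I2)
          fix z :: 'a
          have "(\<lambda>n. x - (1 / Suc n) *\<^sub>R z) \<longlonglongrightarrow> x - 0 *\<^sub>R z"
            by (intro tendsto_intros LIMSEQ_Suc lim_1_over_n)
          then have "(\<lambda>n. \<phi> (x - (1 / Suc n) *\<^sub>R z)) \<longlonglongrightarrow> \<phi> x"
            using cont by (intro isCont_tendsto_compose[of x \<phi>]) (auto simp: continuous_on_eq_continuous_at)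
          then show "(\<lambda>n. \<phi> (x - (1 / Suc n) *\<^sub>R z) * gauss_kernel 1 z) \<longlonglongrightarrow> \<phi> x * gauss_kernel 1 z"
            by (intro tendsto_mult tendsto_const)
        qed
      qed (use k bound in auto)
      then show "(\<lambda>n. ?u n x) \<longlonglongrightarrow> \<phi> x" using k by simp
    qed
    show "AE x in M. norm (?u n x) \<le> B" for n
    proof (rule AE_I2)
      fix x
      have "norm (?u n x) \<le> (LINT z|lborel. B * gauss_kernel 1 (z::'a))"
        unfolding real_norm_def
        by (rule integral_abs_bound[THEN order_trans], rule integral_mono') (use k bound[THEN order_trans[OF abs_ge_zero]] bound in auto)
      then show "norm (?u n x) \<le> B" using k by simp
    qed
  qed auto
  then show ?thesis unfolding eq .
qed

text \<open>Duality: damped Parseval turns the smoothed integral of \<open>\<phi>\<close> against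
  \<open>\<mu> - \<nu>\<close> into a frequency integral. Cauchy--Schwarz separates the energy of
  the difference, at most \<open>q\<close>, from the damped energy of \<open>\<phi>\<close>, at most
  \<open>(2 * pi) ^ DIM('a) * V\<close>. The result does not depend on the kernel width, which then
  tends to 0.\<close>

lemma integral_diff_le_ft_diff:
  fixes \<phi> :: "'a::euclidean_space \<Rightarrow> real"
  assumes \<mu>: "finite_measure \<mu>" "sets \<mu> = sets borel" and \<nu>: "finite_measure \<nu>" "sets \<nu> = sets borel"
    and cont: "continuous_on UNIV \<phi>" and B: "\<And>x. \<bar>\<phi> x\<bar> \<le> 1" and \<phi>: "integrable lborel \<phi>"
    and V: "(LINT x|lborel. \<bar>\<phi> x\<bar>) \<le> V"
    and Q: "(\<integral>\<^sup>+\<omega>. ennreal ((cmod (ft \<mu> (\<lambda>_. 1) \<omega> - ft \<nu> (\<lambda>_. 1) \<omega>))\<^sup>2) \<partial>lborel) \<le> ennreal q" and q: "q \<ge> 0"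
  shows "(LINT x|\<mu>. \<phi> x) - (LINT x|\<nu>. \<phi> x) \<le> sqrt (V * q)"
proof (rule LIMSEQ_le_const2)
  interpret \<mu>: finite_measure \<mu> by fact
  interpret \<nu>: finite_measure \<nu> by fact
  note sf = \<mu>.sigma_finite_measure_axioms \<nu>.sigma_finite_measure_axioms lborel.sigma_finite_measure_axioms
  let ?X = "\<lambda>M n. LINT p|(M \<Otimes>\<^sub>M lborel). \<phi> (snd p) * gauss_kernel (1 / Suc n) (fst p - snd p)"
  show "(\<lambda>n. ?X \<mu> n - ?X \<nu> n) \<longlonglongrightarrow> (LINT x|\<mu>. \<phi> x) - (LINT x|\<nu>. \<phi> x)"
    by (intro tendsto_diff gauss_kernel_approx_identity[OF \<mu> cont B \<phi>] gauss_kernel_approx_identity[OF \<nu> cont B \<phi>])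
  have [measurable]: "\<phi> \<in> borel_measurable borel"
    using cont by (rule borel_measurable_continuous_onI)
  have "0 \<le> (LINT x|lborel. \<bar>\<phi> x\<bar>)" by simp
  then have V0: "V \<ge> 0" using V by linarith
  have "?X \<mu> n - ?X \<nu> n \<le> sqrt (V * q)" for n
  proof -
    define s :: real where "s = 1 / Suc n"
    have s: "s > 0" by (simp add: s_def)
    define c where "c = (2 * pi) ^ DIM('a)"
    \<comment> \<open>Parseval leaves \<open>c\<close> squared on the left and Plancherel a single
      \<open>c\<close> on the right; \<open>c \<ge> 1\<close> lets the surplus factor be
      dropped.\<close>
    have c: "c \<ge> 1" unfolding c_def using pi_ge_two by (intro one_le_power) simp
    let ?G = "\<lambda>\<omega>::'a. exp (- (s * norm \<omega>)\<^sup>2 / 2)"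
    let ?f = "\<lambda>\<omega>. ft \<mu> (\<lambda>_. 1) \<omega> - ft \<nu> (\<lambda>_. 1) \<omega>"
    let ?h = "ft lborel \<phi>"
    have [measurable]: "ft \<mu> (\<lambda>_. 1) \<in> borel_measurable borel"
      by (rule ft_measurable[OF sf(1) \<mu>(2)]) simp
    have [measurable]: "ft \<nu> (\<lambda>_. 1) \<in> borel_measurable borel"
      by (rule ft_measurable[OF sf(2) \<nu>(2)]) simp
    have [measurable]: "?h \<in> borel_measurable borel"
      by (rule ft_measurable[OF sf(3)]) simp_all
    have [measurable]: "(\<lambda>\<omega>. cnj (?h \<omega>)) \<in> borel_measurable borel"
      by (rule measurable_compose[OF \<open>?h \<in> _\<close>])
        (intro borel_measurable_continuous_onI continuous_intros)
    have id: "of_real (c * ?X M n) = (LINT \<omega>|lborel. ft M (\<lambda>_. 1) \<omega> * cnj (?h \<omega>) * of_real (?G \<omega>))"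
      if M: "finite_measure M" "sets M = sets borel" for M
    proof -
      interpret finite_measure M by fact
      show ?thesis
        using integral_gauss_kernel_pair(2)[OF s, of M "\<lambda>_. 1" lborel \<phi>] M \<phi> sf sigma_finite_measure_axioms
        by (simp add: c_def s_def)
    qed
    have bd: "cmod (?h \<omega>) \<le> V" for \<omega>
      by (rule order_trans[OF norm_ft_le V]) (auto simp: \<phi>)
    have I: "integrable lborel (\<lambda>\<omega>. ft M (\<lambda>_. 1) \<omega> * cnj (?h \<omega>) * of_real (?G \<omega>))"
      if M: "finite_measure M" "sets M = sets borel" for M
    proof (rule Bochner_Integration.integrable_bound)
      interpret finite_measure M by fact
      have [measurable]: "ft M (\<lambda>_. 1) \<in> borel_measurable borel"
        by (intro ft_measurable M sigma_finite_measure_axioms) auto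
      show "(\<lambda>\<omega>. ft M (\<lambda>_. 1) \<omega> * cnj (?h \<omega>) * of_real (?G \<omega>)) \<in> borel_measurable lborel"
        by measurable
      show "integrable lborel (\<lambda>\<omega>. measure M (space M) * V * ?G \<omega>)"
        by (intro integrable_mult_right fourier_gaussian(1)[OF s])
      have "cmod (ft M (\<lambda>_. 1) \<omega>) \<le> measure M (space M)" for \<omega>
        using norm_ft_le[of M "\<lambda>_. 1" \<omega>] M by simp
      then show "AE \<omega> in lborel. norm (ft M (\<lambda>_. 1) \<omega> * cnj (?h \<omega>) * of_real (?G \<omega>))
           \<le> norm (measure M (space M) * V * ?G \<omega>)"
        using bd V0 by (intro AE_I2) (auto simp: norm_mult abs_mult intro!: mult_mono)
    qed
    have "complex_of_real (c * (?X \<mu> n - ?X \<nu> n)) = (LINT \<omega>|lborel. ?f \<omega> * cnj (?h \<omega>) * of_real (?G \<omega>))"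
      unfolding right_diff_distrib of_real_diff id[OF \<mu>] id[OF \<nu>]
      by (subst Bochner_Integration.integral_diff[symmetric, OF I[OF \<mu>] I[OF \<nu>]]) (simp only: left_diff_distrib)
    then have "norm (complex_of_real (c * (?X \<mu> n - ?X \<nu> n))) = norm (LINT \<omega>|lborel. ?f \<omega> * cnj (?h \<omega>) * of_real (?G \<omega>))"
      by (rule arg_cong)
    then have "ennreal (norm (c * (?X \<mu> n - ?X \<nu> n))) = norm (LINT \<omega>|lborel. ?f \<omega> * cnj (?h \<omega>) * of_real (?G \<omega>))"
      by (simp only: norm_of_real real_norm_def)
    also have "\<dots> \<le> (\<integral>\<^sup>+\<omega>. ennreal (norm (?f \<omega> * cnj (?h \<omega>) * of_real (?G \<omega>))) \<partial>lborel)"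
    proof (rule integral_norm_bound_ennreal)
      show "integrable lborel (\<lambda>\<omega>. ?f \<omega> * cnj (?h \<omega>) * of_real (?G \<omega>))"
        using Bochner_Integration.integrable_diff[OF I[OF \<mu>] I[OF \<nu>]] by (simp only: left_diff_distrib)
    qed
    also have "\<dots> = (\<integral>\<^sup>+\<omega>. ennreal (norm (?f \<omega>)) * ennreal (norm (?h \<omega>) * ?G \<omega>) \<partial>lborel)"
      by (simp add: norm_mult ennreal_mult mult.assoc)
    finally have "(ennreal (norm (c * (?X \<mu> n - ?X \<nu> n))))\<^sup>2 \<le>
       (\<integral>\<^sup>+\<omega>. ennreal (norm (?f \<omega>)) * ennreal (norm (?h \<omega>) * ?G \<omega>) \<partial>lborel)\<^sup>2"
      by (intro power_mono) auto
    also have "\<dots> \<le> (\<integral>\<^sup>+\<omega>. (ennreal (norm (?f \<omega>)))\<^sup>2 \<partial>lborel) * (\<integral>\<^sup>+\<omega>. (ennreal (norm (?h \<omega>) * ?G \<omega>))\<^sup>2 \<partial>lborel)"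
      by (rule Cauchy_Schwarz_nn_integral) measurable
    also have "\<dots> \<le> ennreal q * ennreal (c * V)"
    proof (rule mult_mono)
      show "(\<integral>\<^sup>+\<omega>. (ennreal (norm (?f \<omega>)))\<^sup>2 \<partial>lborel) \<le> ennreal q"
        using Q by (simp add: ennreal_power)
      \<comment> \<open>Squaring the damping factor doubles its exponent, that is, replaces
        \<open>s\<close> by \<open>sqrt 2 * s\<close>.\<close>
      have s2: "sqrt 2 * s > 0" using s by simp
      have eq: "(norm (?h \<omega>) * ?G \<omega>)\<^sup>2 = (cmod (?h \<omega>))\<^sup>2 * exp (- (sqrt 2 * s * norm \<omega>)\<^sup>2 / 2)" for \<omega>
        by (simp add: power_mult_distrib exp_double[symmetric])
      have "(\<integral>\<^sup>+\<omega>. (ennreal (norm (?h \<omega>) * ?G \<omega>))\<^sup>2 \<partial>lborel)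
        = (\<integral>\<^sup>+\<omega>. ennreal ((cmod (?h \<omega>))\<^sup>2 * exp (- (sqrt 2 * s * norm \<omega>)\<^sup>2 / 2)) \<partial>lborel)"
        by (simp only: ennreal_power mult_nonneg_nonneg norm_ge_zero exp_ge_zero eq)
      also have "\<dots> = ennreal (LINT \<omega>|lborel. (cmod (?h \<omega>))\<^sup>2 * exp (- (sqrt 2 * s * norm \<omega>)\<^sup>2 / 2))"
        by (rule nn_integral_eq_integral) (use plancherel_gauss_le(1)[OF s2 \<phi> B] in auto)
      also have "\<dots> \<le> ennreal (c * V)"
      proof (rule ennreal_leI)
        have "(LINT \<omega>|lborel. (cmod (?h \<omega>))\<^sup>2 * exp (- (sqrt 2 * s * norm \<omega>)\<^sup>2 / 2)) \<le> c * (1 * (LINT x|lborel. \<bar>\<phi> x\<bar>))"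
          unfolding c_def by (rule plancherel_gauss_le(2)[OF s2 \<phi> B])
        also have "\<dots> \<le> c * V" using V c by (intro mult_left_mono) auto
        finally show "(LINT \<omega>|lborel. (cmod (?h \<omega>))\<^sup>2 * exp (- (sqrt 2 * s * norm \<omega>)\<^sup>2 / 2)) \<le> c * V" .
      qed
      finally show "(\<integral>\<^sup>+\<omega>. (ennreal (norm (?h \<omega>) * ?G \<omega>))\<^sup>2 \<partial>lborel) \<le> ennreal (c * V)" .
    qed auto
    finally have "(norm (c * (?X \<mu> n - ?X \<nu> n)))\<^sup>2 \<le> q * (c * V)"
      using q c V0 by (simp add: ennreal_power ennreal_mult[symmetric])
    then have "c\<^sup>2 * (?X \<mu> n - ?X \<nu> n)\<^sup>2 \<le> q * (c * V)" by (simp add: power_mult_distrib)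
    also have "\<dots> \<le> c\<^sup>2 * (V * q)"
    proof -
      have "1 * (q * V) \<le> c * (q * V)" using c q V0 by (intro mult_right_mono) auto
      then have "c * (q * V) \<le> c * (c * (q * V))" using c q V0 by (intro mult_left_mono) auto
      then show ?thesis by (simp add: power2_eq_square mult_ac)
    qed
    finally have "(?X \<mu> n - ?X \<nu> n)\<^sup>2 \<le> V * q" using c by simp
    then show ?thesis by (rule real_le_rsqrt)
  qed
  then show "\<exists>N. \<forall>n\<ge>N. ?X \<mu> n - ?X \<nu> n \<le> sqrt (V * q)" by blast
qed

lemma measure_compact_diff_le:
  fixes K :: "'a::euclidean_space set"
  assumes \<mu>: "finite_measure \<mu>" "sets \<mu> = sets borel" and \<nu>: "finite_measure \<nu>" "sets \<nu> = sets borel"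
    and K: "compact K" "K \<subseteq> cball 0 R" and R: "R \<ge> 0"
    and Q: "(\<integral>\<^sup>+\<omega>. ennreal ((cmod (ft \<mu> (\<lambda>_. 1) \<omega> - ft \<nu> (\<lambda>_. 1) \<omega>))\<^sup>2) \<partial>lborel) \<le> ennreal q" and q: "q \<ge> 0"
  shows "measure \<mu> K - measure \<nu> K \<le> sqrt (measure lborel (cball (0::'a) (R + 1)) * q)"
proof (cases "K = {}")
  \<comment> \<open>Treated apart because \<open>infdist x {}\<close> is 0, which would make the
    test functions below constantly 1.\<close>
  case True
  then show ?thesis using q by simp
next
  case False
  note [measurable_cong] = \<mu>(2) \<nu>(2)
  interpret \<mu>: finite_measure \<mu> by fact
  interpret \<nu>: finite_measure \<nu> by fact
  let ?V = "measure lborel (cball (0::'a) (R + 1))"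
  \<comment> \<open>Continuous functions tending pointwise to the indicator of \<open>K\<close>. The
    slope \<open>Suc n\<close> is at least 1, so each vanishes at distance 1 or more from
    \<open>K\<close>; this is the origin of the radius \<open>R + 1\<close>.\<close>
  let ?\<phi> = "\<lambda>n x. max 0 (1 - real (Suc n) * infdist x K)"
  have cl: "closed K" using K by (simp add: compact_imp_closed)
  then have [measurable]: "K \<in> sets borel" by auto
  have cont: "continuous_on UNIV (?\<phi> n)" for n by (intro continuous_intros)
  then have [measurable]: "?\<phi> n \<in> borel_measurable borel" for n by (rule borel_measurable_continuous_onI)
  have B: "\<bar>?\<phi> n x\<bar> \<le> 1" for n x using infdist_nonneg[of x K] by (auto simp: abs_if max_def)
  have supp: "?\<phi> n x \<le> indicator (cball 0 (R + 1)) x" for n x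
  proof (cases "x \<in> cball 0 (R + 1)")
    case True
    then show ?thesis using B[of n x] by simp
  next
    case x: False
    obtain y where y: "y \<in> K" "infdist x K = dist x y"
      using infdist_attains_inf[OF cl False] by metis
    have "norm x \<le> norm y + dist x y" by (simp add: dist_norm norm_triangle_sub)
    moreover have "norm y \<le> R" using y K by auto
    ultimately have "infdist x K \<ge> 1" using x y by auto
    then have "1 * 1 \<le> real (Suc n) * infdist x K" by (intro mult_mono) auto
    then show ?thesis using x by simp
  qed
  have ind: "integrable lborel (indicator (cball (0::'a) (R + 1)) :: 'a \<Rightarrow> real)"
    by (intro integrable_real_indicator) (use R in \<open>auto simp: emeasure_cball\<close>)
  have int: "integrable lborel (?\<phi> n)" for n
  proof (rule Bochner_Integration.integrable_bound[OF ind])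
    show "?\<phi> n \<in> borel_measurable lborel"
      unfolding measurable_lborel2 by (rule borel_measurable_continuous_onI[OF cont])
    show "AE x in lborel. norm (?\<phi> n x) \<le> norm (indicator (cball (0::'a) (R + 1)) x :: real)"
      using supp[of n] by (intro AE_I2) (simp del: of_nat_Suc)
  qed
  have V: "(LINT x|lborel. \<bar>?\<phi> n x\<bar>) \<le> ?V" for n
  proof -
    have "(LINT x|lborel. \<bar>?\<phi> n x\<bar>) \<le> (LINT x|lborel. indicator (cball (0::'a) (R + 1)) x)"
      using int[of n] ind supp[of n] by (intro integral_mono) auto
    then show ?thesis by simp
  qed
  have lim: "(\<lambda>n. LINT x|M. ?\<phi> n x) \<longlonglongrightarrow> measure M K" if M: "finite_measure M" "sets M = sets borel" for M
  proof -
    note [measurable_cong] = M(2)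
    interpret finite_measure M by fact
    have "(\<lambda>n. LINT x|M. ?\<phi> n x) \<longlonglongrightarrow> (LINT x|M. indicator K x)"
    proof (rule integral_dominated_convergence[where w="\<lambda>_. 1"])
      show "AE x in M. (\<lambda>n. ?\<phi> n x) \<longlonglongrightarrow> indicator K x"
      proof (rule AE_I2)
        fix x
        show "(\<lambda>n. ?\<phi> n x) \<longlonglongrightarrow> indicator K x"
        proof (cases "x \<in> K")
          case False
          then have pos: "infdist x K > 0"
            using in_closed_iff_infdist_zero[OF cl \<open>K \<noteq> {}\<close>, of x] infdist_nonneg[of x K] by simp
          obtain N where N: "1 < real N * infdist x K" using reals_Archimedean3[OF pos] by blast
          have "?\<phi> n x = 0" if "n \<ge> N" for n
          proof -
            have "real N * infdist x K \<le> real (Suc n) * infdist x K"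
              using that pos by (intro mult_right_mono) auto
            then show ?thesis using N by simp
          qed
          then have "eventually (\<lambda>n. ?\<phi> n x = 0) sequentially"
            unfolding eventually_sequentially by blast
          then show ?thesis using False by (simp add: tendsto_eventually)
        qed simp
      qed
      show "?\<phi> n \<in> borel_measurable M" for n
        unfolding measurable_cong_sets[OF M(2) refl] by (rule borel_measurable_continuous_onI[OF cont])
      show "AE x in M. norm (?\<phi> n x) \<le> 1" for n
        using B[of n] by (intro AE_I2) (simp only: real_norm_def)
    qed auto
    then show ?thesis using M by (simp add: measure_def[symmetric] sets_eq_imp_space_eq)
  qed
  show ?thesis
  proof (rule LIMSEQ_le_const2)
    show "(\<lambda>n. (LINT x|\<mu>. ?\<phi> n x) - (LINT x|\<nu>. ?\<phi> n x)) \<longlonglongrightarrow> measure \<mu> K - measure \<nu> K"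
      by (intro tendsto_diff lim \<mu> \<nu>)
    show "\<exists>N. \<forall>n\<ge>N. (LINT x|\<mu>. ?\<phi> n x) - (LINT x|\<nu>. ?\<phi> n x) \<le> sqrt (?V * q)"
      using integral_diff_le_ft_diff[OF \<mu> \<nu> cont B int V Q q] by blast
  qed
qed

section \<open>Half-space profiles and low frequencies\<close>

text \<open>Up to endpoints \<open>h\<close> is the signed indicator of the interval between 0 and
  \<open>s\<close>, so the last claim is the fundamental theorem of calculus for the exponential.
  Keeping the factor \<open>t\<close> on the left, instead of dividing by it, covers
  \<open>t = 0\<close>.\<close>

lemma integral_step_difference:
  fixes s t :: real
  defines "h \<equiv> \<lambda>b. (of_bool (b \<le> s) - of_bool (b \<le> 0) :: real)"
  shows "integrable lborel h" "(LINT b|lborel. \<bar>h b\<bar>) = \<bar>s\<bar>"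
    and "- \<i> * of_real t * ft lborel h t = exp (- \<i> * of_real (s * t)) - 1"
proof -
  let ?e = "\<lambda>b::real. exp (- \<i> * of_real (b * t))"
  \<comment> \<open>Sorted endpoints and a sign treat positive and negative \<open>s\<close>
    together; for \<open>s = 0\<close> the sign is 0.\<close>
  define l u \<sigma> where "l = min s 0" and "u = max s 0" and "\<sigma> = sgn s"
  have lu: "l \<le> u" by (simp add: l_def u_def)
  have h: "AE b in lborel. h b = \<sigma> * indicator {l..u} b"
    using AE_lborel_singleton[of 0] AE_lborel_singleton[of s]
    by eventually_elim (auto simp: h_def \<sigma>_def l_def u_def sgn_if indicator_def)
  have [measurable]: "h \<in> borel_measurable borel" unfolding h_def by measurable
  have I: "integrable lborel (\<lambda>b. \<sigma> * indicator {l..u} b :: real)"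
    by (intro integrable_mult_right integrable_real_indicator) (auto simp: emeasure_lborel_Icc_eq)
  show "integrable lborel h"
    using I h by (subst integrable_cong_AE[OF _ _ h]) auto
  have "(LINT b|lborel. \<bar>h b\<bar>) = (LINT b|lborel. \<bar>\<sigma>\<bar> * indicator {l..u} b)"
    using h by (intro integral_cong_AE) (auto elim!: eventually_mono simp: abs_mult)
  then show "(LINT b|lborel. \<bar>h b\<bar>) = \<bar>s\<bar>"
    using lu by (auto simp: \<sigma>_def l_def u_def sgn_if split: if_splits)
  have "((\<lambda>b. exp (- \<i> * of_real t * of_real b)) has_vector_derivative (- \<i> * of_real t * ?e b)) (at b within A)" for b A
    by (rule has_vector_derivative_real_field) (auto intro!: derivative_eq_intros simp: mult_ac)
  then have d: "(?e has_vector_derivative (- \<i> * of_real t * ?e b)) (at b within A)" for b A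
    by (simp add: mult_ac)
  have fi: "has_bochner_integral lborel (\<lambda>b. indicator {l..u} b *\<^sub>R (- \<i> * of_real t * ?e b)) (?e u - ?e l)"
    by (rule has_bochner_integral_FTC_Icc[OF lu d]) (intro continuous_intros)
  have "- \<i> * of_real t * ft lborel h t = (LINT b|lborel. - \<i> * of_real t * (?e b * of_real (h b)))"
    unfolding ft_def by (simp add: inner_real_def)
  also have "\<dots> = (LINT b|lborel. of_real \<sigma> * (indicator {l..u} b *\<^sub>R (- \<i> * of_real t * ?e b)))"
  proof (intro integral_cong_AE)
    show "AE b in lborel. - \<i> * of_real t * (?e b * of_real (h b)) =
        of_real \<sigma> * (indicator {l..u} b *\<^sub>R (- \<i> * of_real t * ?e b))"
      using h
    proof eventually_elim
      case (elim b)
      then have "complex_of_real (h b) = of_real \<sigma> * of_real (indicator {l..u} b)"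
        by (simp only: of_real_mult)
      then show ?case by (simp only: scaleR_conv_of_real mult_ac)
    qed
  qed measurable
  also have "\<dots> = of_real \<sigma> * (?e u - ?e l)"
    using has_bochner_integral_integral_eq[OF fi] by (simp only: integral_mult_right_zero)
  also have "\<dots> = exp (- \<i> * of_real (s * t)) - 1"
    by (auto simp: \<sigma>_def l_def u_def sgn_if)
  finally show "- \<i> * of_real t * ft lborel h t = exp (- \<i> * of_real (s * t)) - 1" .
qed

text \<open>Subtracting the step function at \<open>0\<close> makes the half-space profile integrable.\<close>

lemma ft_half_space_profile:
  fixes M :: "'a::euclidean_space measure"
  assumes M: "prob_space M" and [measurable_cong]: "sets M = sets borel"
    and m1: "integrable M norm"
  defines "G \<equiv> \<lambda>v b. measure M {x. x \<bullet> v \<ge> b} - of_bool (b \<le> 0)"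
  shows "integrable lborel (G v)"
    and "- \<i> * of_real t * ft lborel (G v) t = ft M (\<lambda>_. 1) (t *\<^sub>R v) - 1"
proof -
  interpret prob_space M by fact
  interpret P: pair_sigma_finite M "lborel::real measure" ..
  have sp: "space M = UNIV" using assms(2) sets_eq_imp_space_eq[of M borel] by simp
  let ?h = "\<lambda>x b. of_bool (b \<le> x \<bullet> v) - of_bool (b \<le> 0) :: real"
  have [measurable]: "(\<lambda>p. ?h (fst p) (snd p)) \<in> borel_measurable (M \<Otimes>\<^sub>M lborel)"
    by measurable
  \<comment> \<open>The profile is the mean over \<open>x\<close> of step differences with
    \<open>L^1\<close> norm \<open>\<bar>x \<bullet> v\<bar>\<close>; the first moment of
    \<open>M\<close> therefore makes Fubini applicable.\<close>
  have int: "integrable (M \<Otimes>\<^sub>M lborel) (\<lambda>p. ?h (fst p) (snd p))"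
  proof (rule P.Fubini_integrable)
    have "integrable M (\<lambda>x. \<bar>x \<bullet> v\<bar>)"
    proof (rule Bochner_Integration.integrable_bound)
      show "integrable M (\<lambda>x. norm x * norm v)" using m1 by simp
    qed (auto simp: Cauchy_Schwarz_ineq2)
    then show "integrable M (\<lambda>x. LINT b|lborel. norm (?h (fst (x, b)) (snd (x, b))))"
      unfolding real_norm_def fst_conv snd_conv integral_step_difference(2) .
  qed (simp_all add: integral_step_difference(1))
  have G: "(LINT x|M. ?h x b) = G v b" for b
  proof -
    have "(LINT x|M. ?h x b) = (LINT x|M. indicator {x. x \<bullet> v \<ge> b} x - of_bool (b \<le> 0))"
      by (simp add: indicator_def of_bool_def)
    also have "\<dots> = measure M {x. x \<bullet> v \<ge> b} - of_bool (b \<le> 0)"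
      by (subst Bochner_Integration.integral_diff) (auto simp: sp prob_space[unfolded sp] less_top[symmetric])
    finally show ?thesis unfolding G_def .
  qed
  have "integrable lborel (\<lambda>b. LINT x|M. ?h x b)"
    by (rule P.integrable_snd) (use int in \<open>simp only: case_prod_unfold\<close>)
  then show GI: "integrable lborel (G v)" unfolding G .
  let ?e = "\<lambda>b::real. exp (- \<i> * of_real (b \<bullet> t))"
  let ?H = "\<lambda>x b. ?e b * of_real (?h x b)"
  have int2: "integrable (M \<Otimes>\<^sub>M lborel) (case_prod ?H)"
    unfolding case_prod_unfold
    by (rule Bochner_Integration.integrable_bound[OF int]) (auto simp: norm_mult simp del: inner_real_def)
  have "ft lborel (G v) t = (LINT b|lborel. LINT x|M. ?H x b)"
    unfolding ft_def G[symmetric]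
    by (simp only: integral_mult_right_zero integral_complex_of_real)
  also have "\<dots> = (LINT x|M. LINT b|lborel. ?H x b)"
    by (rule P.Fubini_integral[OF int2])
  also have "\<dots> = (LINT x|M. ft lborel (?h x) t)"
    by (simp only: ft_def)
  finally have "- \<i> * of_real t * ft lborel (G v) t = (LINT x|M. - \<i> * of_real t * ft lborel (?h x) t)"
    by (simp only: integral_mult_right_zero)
  also have "\<dots> = (LINT x|M. exp (- \<i> * of_real (x \<bullet> (t *\<^sub>R v))) * of_real 1 - 1)"
    unfolding integral_step_difference(3) by (simp add: mult.commute)
  also have "\<dots> = ft M (\<lambda>_. 1) (t *\<^sub>R v) - 1"
    unfolding ft_def using integrable_ft[of M "\<lambda>_. 1" "t *\<^sub>R v"] assms(2) prob_space
    by (subst Bochner_Integration.integral_diff) auto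
  finally show "- \<i> * of_real t * ft lborel (G v) t = ft M (\<lambda>_. 1) (t *\<^sub>R v) - 1" .
qed

lemma nn_integral_lborel_scaleR:
  fixes f :: "'a::euclidean_space \<Rightarrow> ennreal"
  assumes [measurable]: "f \<in> borel_measurable borel" and "t > 0"
  shows "(\<integral>\<^sup>+x. f x \<partial>lborel) = ennreal (t ^ DIM('a)) * (\<integral>\<^sup>+x. f (t *\<^sub>R x) \<partial>lborel)"
  using assms(2) by (subst lborel_affine[of t 0]) (auto simp: nn_integral_density nn_integral_distr nn_integral_cmult)

section \<open>Low-frequency energy of the difference of two laws\<close>

context
  fixes \<mu> \<nu> :: "'a::euclidean_space measure"
  assumes \<mu>: "prob_space \<mu>" "sets \<mu> = sets borel" "integrable \<mu> norm"
    and \<nu>: "prob_space \<nu>" "sets \<nu> = sets borel" "integrable \<nu> norm"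
begin

definition profile :: "'a \<Rightarrow> real \<Rightarrow> real" where
  "profile v b = measure \<mu> {x. x \<bullet> v \<ge> b} - measure \<nu> {x. x \<bullet> v \<ge> b}"

definition ft_diff :: "'a \<Rightarrow> complex" where
  "ft_diff \<omega> = ft \<mu> (\<lambda>_. 1) \<omega> - ft \<nu> (\<lambda>_. 1) \<omega>"

lemma ft_diff_measurable [measurable]: "ft_diff \<in> borel_measurable borel"
proof -
  interpret \<mu>: prob_space \<mu> by fact
  interpret \<nu>: prob_space \<nu> by fact
  have [measurable]: "ft \<mu> (\<lambda>_. 1) \<in> borel_measurable borel"
    by (rule ft_measurable[OF \<mu>.sigma_finite_measure_axioms \<mu>(2)]) simp
  have [measurable]: "ft \<nu> (\<lambda>_. 1) \<in> borel_measurable borel"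
    by (rule ft_measurable[OF \<nu>.sigma_finite_measure_axioms \<nu>(2)]) simp
  show ?thesis unfolding ft_diff_def[abs_def] by measurable
qed

lemma integrable_profile: "integrable lborel (profile v)"
  using Bochner_Integration.integrable_diff[OF ft_half_space_profile(1)[OF \<mu>, of v] ft_half_space_profile(1)[OF \<nu>, of v]]
  unfolding profile_def[abs_def] by simp

text \<open>The step function at 0 and the constant -1 in \<open>ft_half_space_profile\<close> are
  the same for both measures and cancel in the difference.\<close>

lemma ft_profile: "- \<i> * of_real t * ft lborel (profile v) t = ft_diff (t *\<^sub>R v)"
proof -
  let ?g = "\<lambda>M b. measure M {x. x \<bullet> v \<ge> b} - of_bool (b \<le> 0)"
  have "ft lborel (profile v) t = (LINT b|lborel. exp (- \<i> * of_real (b \<bullet> t)) * of_real (?g \<mu> b)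
      - exp (- \<i> * of_real (b \<bullet> t)) * of_real (?g \<nu> b))"
    unfolding ft_def profile_def by (intro Bochner_Integration.integral_cong refl) (simp add: algebra_simps)
  also have "\<dots> = ft lborel (?g \<mu>) t - ft lborel (?g \<nu>) t"
    unfolding ft_def
    by (intro Bochner_Integration.integral_diff integrable_ft ft_half_space_profile(1) \<mu> \<nu> sets_lborel)
  finally have "- \<i> * of_real t * ft lborel (profile v) t =
      - \<i> * of_real t * ft lborel (?g \<mu>) t - - \<i> * of_real t * ft lborel (?g \<nu>) t"
    by (simp only: right_diff_distrib)
  then show ?thesis
    unfolding ft_half_space_profile(2)[OF \<mu>] ft_half_space_profile(2)[OF \<nu>] ft_diff_def by simp
qed

text \<open>Plancherel on the line with damping scale \<open>1 / T\<close>, matched to the window: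
  there \<open>t / T\<close> is at most 2, so undoing the Gaussian costs at most
  \<open>exp 2\<close>, and the squared factor \<open>t\<close> costs at most
  \<open>4 * T\<^sup>2\<close>. The remaining \<open>2 * pi\<close> comes from
  \<open>plancherel_gauss_le\<close>.\<close>

lemma ft_diff_ray_bound:
  assumes T: "T > 0" and D: "\<And>b. \<bar>profile v b\<bar> \<le> D" and W: "(LINT b|lborel. \<bar>profile v b\<bar>) \<le> W"
  shows "(\<integral>\<^sup>+t. ennreal ((cmod (ft_diff (t *\<^sub>R v)))\<^sup>2) * indicator {T..2 * T} t \<partial>lborel)
    \<le> ennreal (8 * pi * exp 2 * T\<^sup>2 * (D * W))"
proof -
  let ?h = "\<lambda>t::real. (cmod (ft lborel (profile v) t))\<^sup>2 * exp (- (1 / T * norm t)\<^sup>2 / 2)"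
  have s: "1 / T > 0" using T by simp
  have D0: "D \<ge> 0" using D[of 0] abs_ge_zero[of "profile v 0"] by linarith
  note pl = plancherel_gauss_le[OF s integrable_profile[of v] D]
  have "(\<integral>\<^sup>+t. ennreal ((cmod (ft_diff (t *\<^sub>R v)))\<^sup>2) * indicator {T..2 * T} t \<partial>lborel)
     \<le> (\<integral>\<^sup>+t. ennreal (4 * T\<^sup>2 * exp 2 * ?h t) \<partial>lborel)"
  proof (intro nn_integral_mono)
    fix t :: real
    show "ennreal ((cmod (ft_diff (t *\<^sub>R v)))\<^sup>2) * indicator {T..2 * T} t \<le> ennreal (4 * T\<^sup>2 * exp 2 * ?h t)"
    proof (cases "t \<in> {T..2 * T}")
      case True
      have "(cmod (ft_diff (t *\<^sub>R v)))\<^sup>2 = t\<^sup>2 * (cmod (ft lborel (profile v) t))\<^sup>2"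
        unfolding ft_profile[symmetric] by (simp add: norm_mult power_mult_distrib)
      also have "\<dots> = t\<^sup>2 * 1 * (cmod (ft lborel (profile v) t))\<^sup>2" by simp
      also have "\<dots> \<le> (2 * T)\<^sup>2 * (exp 2 * exp (- (1 / T * norm t)\<^sup>2 / 2)) * (cmod (ft lborel (profile v) t))\<^sup>2"
      proof (intro mult_right_mono mult_mono power_mono)
        have "1 / T * norm t \<le> 2" using True T by (simp add: field_simps)
        then have "(1 / T * norm t)\<^sup>2 \<le> 2\<^sup>2" using T by (intro power_mono) auto
        then show "1 \<le> exp 2 * exp (- (1 / T * norm t)\<^sup>2 / 2)"
          by (simp add: exp_add[symmetric] del: times_divide_eq_left)
      qed (use True T in auto)
      finally show ?thesis using True by (simp add: power_mult_distrib mult_ac ennreal_leI)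
    qed simp
  qed
  also have "\<dots> = ennreal (LINT t|lborel. 4 * T\<^sup>2 * exp 2 * ?h t)"
    by (intro nn_integral_eq_integral integrable_mult_right pl(1)) auto
  also have "\<dots> \<le> ennreal (8 * pi * exp 2 * T\<^sup>2 * (D * W))"
  proof (rule ennreal_leI)
    have "(LINT t|lborel. ?h t) \<le> (2 * pi) * (D * (LINT b|lborel. \<bar>profile v b\<bar>))"
      using pl(2) by simp
    also have "\<dots> \<le> (2 * pi) * (D * W)" using W D0 by (intro mult_left_mono) auto
    finally have "4 * T\<^sup>2 * exp 2 * (LINT t|lborel. ?h t) \<le> 4 * T\<^sup>2 * exp 2 * ((2 * pi) * (D * W))"
      by (intro mult_left_mono) auto
    then show "(LINT t|lborel. 4 * T\<^sup>2 * exp 2 * ?h t) \<le> 8 * pi * exp 2 * T\<^sup>2 * (D * W)"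
      by (simp only: integral_mult_right_zero) (simp add: mult_ac)
  qed
  finally show ?thesis .
qed

text \<open>For every \<open>t\<close> in the window from \<open>T\<close> to \<open>2 * T\<close>,
  the ball of radius \<open>T\<close> lies in \<open>t\<close> times the unit ball, so after
  dilation \<open>?J\<close> is at most \<open>(2 * T) ^ DIM('a)\<close> times an integral over
  directions \<open>v\<close> in the unit ball. Integrating over the window and exchanging the
  integrals leaves the ray bound for each fixed \<open>v\<close>.\<close>

lemma ft_diff_low_frequency:
  assumes T: "T > 0" and D: "\<And>v b. \<bar>profile v b\<bar> \<le> D"
    and W: "\<And>v. norm v \<le> 1 \<Longrightarrow> (LINT b|lborel. \<bar>profile v b\<bar>) \<le> W"
  shows "(\<integral>\<^sup>+\<omega>. ennreal ((cmod (ft_diff \<omega>))\<^sup>2) * indicator (cball 0 T) \<omega> \<partial>lborel)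
    \<le> ennreal (2 ^ DIM('a) * unit_ball_vol (real DIM('a)) * 8 * pi * exp 2 * T ^ (DIM('a) + 1) * (D * W))"
    (is "?J \<le> _")
proof -
  let ?f = "\<lambda>\<omega>. ennreal ((cmod (ft_diff \<omega>))\<^sup>2)"
  have meas: "(\<lambda>t. \<integral>\<^sup>+v. ?f (t *\<^sub>R v) * a v * c t \<partial>lborel) \<in> borel_measurable lborel"
    if [measurable]: "a \<in> borel_measurable borel" "c \<in> borel_measurable borel" for a and c :: "real \<Rightarrow> ennreal"
    by measurable
  have swap: "(\<integral>\<^sup>+t. \<integral>\<^sup>+v. ?f (t *\<^sub>R v) * a v * c t \<partial>lborel \<partial>lborel)
     = (\<integral>\<^sup>+v. \<integral>\<^sup>+t. ?f (t *\<^sub>R v) * a v * c t \<partial>lborel \<partial>lborel)"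
    if [measurable]: "a \<in> borel_measurable borel" "c \<in> borel_measurable borel" for a and c :: "real \<Rightarrow> ennreal"
    by (rule lborel_pair.Fubini') measurable
  have D0: "D \<ge> 0" using D[of 0 0] abs_ge_zero[of "profile 0 0"] by linarith
  have "0 \<le> (LINT b|lborel. \<bar>profile 0 b\<bar>)" by simp
  moreover have "(LINT b|lborel. \<bar>profile 0 b\<bar>) \<le> W" by (rule W) simp
  ultimately have W0: "W \<ge> 0" by linarith
  let ?k = "8 * pi * exp 2 * T\<^sup>2 * (D * W)"
  have k0: "?k \<ge> 0" using D0 W0 by simp
  \<comment> \<open>\<open>?J\<close> does not depend on \<open>t\<close> and the window has length
    \<open>T\<close>. Cancelling this factor at the end lowers the exponent from
    \<open>DIM('a) + 2\<close> to \<open>DIM('a) + 1\<close>.\<close>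
  have "ennreal T * ?J = (\<integral>\<^sup>+t. ?J * indicator {T..2 * T} t \<partial>lborel)"
    using T by (subst nn_integral_cmult_indicator) (auto simp: mult.commute)
  also have "\<dots> \<le> (\<integral>\<^sup>+t. ennreal ((2 * T) ^ DIM('a)) *
      (\<integral>\<^sup>+v. ?f (t *\<^sub>R v) * indicator (cball 0 1) v * indicator {T..2 * T} t \<partial>lborel) \<partial>lborel)"
  proof (intro nn_integral_mono)
    fix t :: real
    show "?J * indicator {T..2 * T} t \<le> ennreal ((2 * T) ^ DIM('a)) *
      (\<integral>\<^sup>+v. ?f (t *\<^sub>R v) * indicator (cball 0 1) v * indicator {T..2 * T} t \<partial>lborel)"
    proof (cases "t \<in> {T..2 * T}")
      case True
      have "?J = ennreal (t ^ DIM('a)) * (\<integral>\<^sup>+v. ?f (t *\<^sub>R v) * indicator (cball 0 T) (t *\<^sub>R v) \<partial>lborel)"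
        by (rule nn_integral_lborel_scaleR) (measurable, use True T in auto)
      also have "\<dots> \<le> ennreal ((2 * T) ^ DIM('a)) * (\<integral>\<^sup>+v. ?f (t *\<^sub>R v) * indicator (cball 0 1) v \<partial>lborel)"
      proof (intro mult_mono nn_integral_mono)
        show "ennreal (t ^ DIM('a)) \<le> ennreal ((2 * T) ^ DIM('a))"
          using True T by (intro ennreal_leI power_mono) auto
        fix v :: 'a
        have "norm v \<le> 1" if "t * norm v \<le> T"
        proof (rule ccontr)
          assume "\<not> norm v \<le> 1"
          then have "t * 1 < t * norm v" using True T by (intro mult_strict_left_mono) auto
          then show False using that True by auto
        qed
        then show "indicator (cball 0 T) (t *\<^sub>R v) \<le> (indicator (cball 0 1) v :: ennreal)"
          using True T by (auto simp: indicator_def)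
      qed auto
      finally show ?thesis using True by simp
    qed simp
  qed
  also have "\<dots> = ennreal ((2 * T) ^ DIM('a)) *
      (\<integral>\<^sup>+t. \<integral>\<^sup>+v. ?f (t *\<^sub>R v) * indicator (cball 0 1) v * indicator {T..2 * T} t \<partial>lborel \<partial>lborel)"
    by (intro nn_integral_cmult meas borel_measurable_indicator) simp_all
  also have "(\<integral>\<^sup>+t. \<integral>\<^sup>+v. ?f (t *\<^sub>R v) * indicator (cball 0 1) v * indicator {T..2 * T} t \<partial>lborel \<partial>lborel)
     = (\<integral>\<^sup>+v. \<integral>\<^sup>+t. ?f (t *\<^sub>R v) * indicator (cball 0 1) v * indicator {T..2 * T} t \<partial>lborel \<partial>lborel)"
    by (intro swap borel_measurable_indicator) simp_all
  also have "\<dots> \<le> (\<integral>\<^sup>+(v::'a). ennreal ?k * indicator (cball 0 1) v \<partial>lborel)"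
  proof (intro nn_integral_mono)
    fix v :: 'a
    show "(\<integral>\<^sup>+t. ?f (t *\<^sub>R v) * indicator (cball 0 1) v * indicator {T..2 * T} t \<partial>lborel) \<le> ennreal ?k * indicator (cball 0 1) v"
      using ft_diff_ray_bound[OF T D W, of v] by (cases "v \<in> cball 0 1") auto
  qed
  also have "\<dots> = ennreal ?k * ennreal (unit_ball_vol (real DIM('a)))"
    using emeasure_cball[of 1 "0::'a"] by (subst nn_integral_cmult_indicator) simp_all
  finally have "ennreal T * ?J \<le> ennreal ((2 * T) ^ DIM('a)) * (ennreal ?k * ennreal (unit_ball_vol (real DIM('a))))"
    by (simp add: mult_left_mono)
  also have "\<dots> = ennreal ((2 * T) ^ DIM('a) * (?k * unit_ball_vol (real DIM('a))))"
    using k0 T by (simp add: ennreal_mult)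
  also have "(2 * T) ^ DIM('a) * (?k * unit_ball_vol (real DIM('a))) =
    T * (2 ^ DIM('a) * unit_ball_vol (real DIM('a)) * 8 * pi * exp 2 * T ^ (DIM('a) + 1) * (D * W))"
    by (simp add: power_mult_distrib power2_eq_square mult_ac)
  finally have "ennreal T * ?J \<le> ennreal T *
      ennreal (2 ^ DIM('a) * unit_ball_vol (real DIM('a)) * 8 * pi * exp 2 * T ^ (DIM('a) + 1) * (D * W))"
    using T by (simp add: ennreal_mult'[symmetric])
  then show ?thesis
    using T by (subst (asm) ennreal_mult_le_mult_iff) auto
qed

end

section \<open>Total variation and perceptron discrepancy\<close>

lemma prob_dist_finite: "prob_dist \<mu> \<Longrightarrow> finite_measure \<mu>"
  by (simp add: prob_dist_def prob_space.finite_measure)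

lemma prob_dist_space:
  fixes \<mu> :: "'a::topological_space measure"
  shows "prob_dist \<mu> \<Longrightarrow> space \<mu> = UNIV"
  using sets_eq_imp_space_eq[of \<mu> borel] by (simp add: prob_dist_def)

text \<open>The complement of the support is a union of open null sets, in general uncountable; by
  the Lindelof property countably many of them have the same union.\<close>

lemma AE_msupport:
  fixes \<mu> :: "'a::second_countable_topology measure"
  assumes sets: "sets \<mu> = sets borel" and sub: "msupport \<mu> \<subseteq> C" and C: "closed C"
  shows "AE x in \<mu>. x \<in> C"
proof -
  let ?F = "{U. open U \<and> emeasure \<mu> U = 0}"
  obtain F' where F': "F' \<subseteq> ?F" "countable F'" "\<Union>F' = \<Union>?F"
    using Lindelof[of ?F] by blast
  have "\<Union>F' \<in> null_sets \<mu>"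
  proof -
    have "S \<in> null_sets \<mu>" if "S \<in> F'" for S
      using F'(1) sets that by (auto simp: null_sets_def)
    then have "(\<Union>S\<in>F'. S) \<in> null_sets \<mu>" by (intro null_sets_UN' F'(2))
    then show ?thesis by simp
  qed
  moreover have "- C \<subseteq> \<Union>?F"
  proof
    fix x assume "x \<in> - C"
    then have "x \<notin> msupport \<mu>" using sub by auto
    then show "x \<in> \<Union>?F" by (auto simp: msupport_def not_less)
  qed
  ultimately show ?thesis
    by (intro AE_I[where N="\<Union>F'"]) (auto simp: F'(3))
qed

lemma measure_half_space_compl:
  fixes M :: "'a::euclidean_space measure"
  assumes M: "prob_dist M"
  shows "measure M {x. x \<bullet> v \<ge> b} = 1 - measure M {x. x \<bullet> v < b}"
proof -
  interpret prob_space M using M by (simp add: prob_dist_def)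
  have "{x. x \<bullet> v \<ge> b} = space M - {x. x \<bullet> v < b}" using prob_dist_space[OF M] by auto
  then show ?thesis
    using M by (simp add: prob_compl prob_dist_def)
qed

context
  fixes \<mu> \<nu> :: "'a::euclidean_space measure"
  assumes \<mu>: "prob_dist \<mu>" and \<nu>: "prob_dist \<nu>"
begin

lemma measure_diff_le_1: "measure \<mu> A - measure \<nu> A \<le> 1"
  using prob_space.prob_le_1[of \<mu> A] measure_nonneg[of \<nu> A] \<mu> unfolding prob_dist_def by linarith

lemma total_variation_ge:
  assumes "A \<in> sets borel"
  shows "measure \<mu> A - measure \<nu> A \<le> total_variation \<mu> \<nu>"
  unfolding total_variation_def
proof (rule cSUP_upper[OF assms])
  show "bdd_above ((\<lambda>A. measure \<mu> A - measure \<nu> A) ` sets borel)"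
  proof (rule bdd_aboveI2)
    fix A show "measure \<mu> A - measure \<nu> A \<le> 1"
      by (rule measure_diff_le_1)
  qed
qed

lemma total_variation_nonneg: "0 \<le> total_variation \<mu> \<nu>"
  using total_variation_ge[of "{}"] by simp

lemma total_variation_le:
  assumes "\<And>A. A \<in> sets borel \<Longrightarrow> measure \<mu> A - measure \<nu> A \<le> c"
  shows "total_variation \<mu> \<nu> \<le> c"
  unfolding total_variation_def using assms by (intro cSUP_least) auto

lemma perceptron_discrepancy_ge:
  "measure \<mu> {x. x \<bullet> v \<ge> b} - measure \<nu> {x. x \<bullet> v \<ge> b} \<le> perceptron_discrepancy \<mu> \<nu>"
proof -
  let ?f = "\<lambda>(v, b). measure \<mu> {x. x \<bullet> v \<ge> b} - measure \<nu> {x. x \<bullet> v \<ge> b}"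
  have "bdd_above (range ?f)"
  proof (rule bdd_aboveI2)
    fix p :: "'a \<times> real"
    show "?f p \<le> 1"
      unfolding case_prod_beta by (rule measure_diff_le_1)
  qed
  then have "?f (v, b) \<le> perceptron_discrepancy \<mu> \<nu>"
    unfolding perceptron_discrepancy_def by (intro cSUP_upper) auto
  then show ?thesis by simp
qed

lemma perceptron_discrepancy_le_1: "perceptron_discrepancy \<mu> \<nu> \<le> 1"
  unfolding perceptron_discrepancy_def
proof (rule cSUP_least)
  fix p :: "'a \<times> real"
  show "(case p of (v, b) \<Rightarrow> measure \<mu> {x. x \<bullet> v \<ge> b} - measure \<nu> {x. x \<bullet> v \<ge> b}) \<le> 1"
    unfolding case_prod_beta by (rule measure_diff_le_1)
qed simp

lemma perceptron_discrepancy_nonneg: "0 \<le> perceptron_discrepancy \<mu> \<nu>"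
  \<comment> \<open>Threshold 1 with \<open>v = 0\<close> gives the empty half-space.\<close>
  using perceptron_discrepancy_ge[of 1 0] by simp

text \<open>The reverse inequality comes from the opposite half-spaces, which exhaust the open complement.\<close>

lemma abs_half_space_le_perceptron_discrepancy:
  "\<bar>measure \<mu> {x. x \<bullet> v \<ge> b} - measure \<nu> {x. x \<bullet> v \<ge> b}\<bar> \<le> perceptron_discrepancy \<mu> \<nu>"
proof -
  let ?H = "\<lambda>n. {x. x \<bullet> (- v) \<ge> - b + 1 / real (Suc n)}"
  have inc: "incseq ?H"
  proof (rule incseq_SucI, rule subsetI)
    fix n x assume "x \<in> ?H n"
    moreover have "1 / real (Suc (Suc n)) \<le> 1 / real (Suc n)" by (simp add: field_simps)
    ultimately show "x \<in> ?H (Suc n)" by (simp del: of_nat_Suc)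
  qed
  have un: "(\<Union>n. ?H n) = {x. x \<bullet> v < b}"
  proof (intro set_eqI iffI)
    fix x assume "x \<in> (\<Union>n. ?H n)"
    then obtain n where "- b + 1 / real (Suc n) \<le> - (x \<bullet> v)" by auto
    moreover have "1 / real (Suc n) > 0" by simp
    ultimately have "x \<bullet> v < b" by linarith
    then show "x \<in> {x. x \<bullet> v < b}" by simp
  next
    fix x assume "x \<in> {x. x \<bullet> v < b}"
    then have "0 < b - x \<bullet> v" by simp
    then obtain n where "inverse (real (Suc n)) < b - x \<bullet> v"
      by (rule reals_Archimedean[THEN exE])
    then have "x \<in> ?H n" by (simp add: inverse_eq_divide)
    then show "x \<in> (\<Union>n. ?H n)" by (rule UN_I[OF UNIV_I])
  qed
  have lim: "(\<lambda>n. measure M (?H n)) \<longlonglongrightarrow> measure M {x. x \<bullet> v < b}" if "prob_dist M" for M :: "'a measure"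
  proof -
    interpret finite_measure M using that by (rule prob_dist_finite)
    have H: "?H n \<in> sets M" for n
    proof -
      have "{x. x \<bullet> (- v) \<ge> c} \<in> sets borel" for c by measurable
      then show ?thesis using that unfolding prob_dist_def by blast
    qed
    show ?thesis unfolding un[symmetric]
      by (rule finite_Lim_measure_incseq[OF _ inc]) (rule image_subsetI, rule H)
  qed
  have "measure \<mu> {x. x \<bullet> v < b} - measure \<nu> {x. x \<bullet> v < b} \<le> perceptron_discrepancy \<mu> \<nu>"
  proof (rule LIMSEQ_le_const2)
    show "(\<lambda>n. measure \<mu> (?H n) - measure \<nu> (?H n)) \<longlonglongrightarrow> measure \<mu> {x. x \<bullet> v < b} - measure \<nu> {x. x \<bullet> v < b}"
      by (intro tendsto_diff lim \<mu> \<nu>)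
    show "\<exists>N. \<forall>n\<ge>N. measure \<mu> (?H n) - measure \<nu> (?H n) \<le> perceptron_discrepancy \<mu> \<nu>"
      using perceptron_discrepancy_ge by blast
  qed
  then show ?thesis
    using perceptron_discrepancy_ge[of b v] measure_half_space_compl[OF \<mu>, of b v] measure_half_space_compl[OF \<nu>, of b v]
    by linarith
qed

text \<open>The Fourier bound is available for compact sets in the ball, and inner regularity of
  \<open>\<mu>\<close> extends it to Borel subsets of the ball. Only the tail of
  \<open>\<mu>\<close> is charged: discarding the part of \<open>A\<close> outside the ball lowers
  \<open>measure \<nu> A\<close>, which has the favourable sign.\<close>

lemma total_variation_le_ft_diff:
  assumes R: "R \<ge> 0" and \<delta>: "measure \<mu> (- cball 0 R) \<le> \<delta>"
    and Q: "(\<integral>\<^sup>+\<omega>. ennreal ((cmod (ft \<mu> (\<lambda>_. 1) \<omega> - ft \<nu> (\<lambda>_. 1) \<omega>))\<^sup>2) \<partial>lborel) \<le> ennreal q" and q: "q \<ge> 0"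
  shows "total_variation \<mu> \<nu> \<le> sqrt (unit_ball_vol (real DIM('a)) * (R + 1) ^ DIM('a) * q) + \<delta>"
    (is "_ \<le> ?s + \<delta>")
proof (rule total_variation_le)
  fix A :: "'a set" assume A: "A \<in> sets borel"
  interpret \<mu>: finite_measure \<mu> using \<mu> by (rule prob_dist_finite)
  interpret \<nu>: finite_measure \<nu> using \<nu> by (rule prob_dist_finite)
  have s\<mu>: "sets \<mu> = sets borel" and s\<nu>: "sets \<nu> = sets borel" using \<mu> \<nu> by (auto simp: prob_dist_def)
  let ?B = "A \<inter> cball 0 R"
  have B: "?B \<in> sets borel" using A by auto
  have "measure \<mu> A \<le> measure \<mu> (?B \<union> (- cball 0 R))"
    using A B s\<mu> by (intro \<mu>.finite_measure_mono) auto
  also have "\<dots> \<le> measure \<mu> ?B + measure \<mu> (- cball 0 R)"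
    using A B s\<mu> by (intro measure_subadditive) auto
  finally have 1: "measure \<mu> A \<le> measure \<mu> ?B + \<delta>" using \<delta> by linarith
  have 2: "measure \<mu> ?B \<le> measure \<nu> ?B + ?s"
  proof -
    have "emeasure \<mu> ?B = (SUP K\<in>{K. K \<subseteq> ?B \<and> compact K}. emeasure \<mu> K)"
      by (rule inner_regular[OF s\<mu> _ B]) simp
    also have "\<dots> \<le> ennreal (measure \<nu> ?B + ?s)"
    proof (rule SUP_least)
      fix K assume "K \<in> {K. K \<subseteq> ?B \<and> compact K}"
      then have K: "K \<subseteq> ?B" "compact K" by auto
      have "measure \<mu> K \<le> measure \<nu> K + ?s"
        using measure_compact_diff_le[OF \<mu>.finite_measure_axioms s\<mu> \<nu>.finite_measure_axioms s\<nu> K(2) _ R Q q] K R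
          content_cball[of "R + 1" "0::'a"] by simp
      also have "measure \<nu> K \<le> measure \<nu> ?B"
        using K B s\<nu> by (intro \<nu>.finite_measure_mono) auto
      finally show "emeasure \<mu> K \<le> ennreal (measure \<nu> ?B + ?s)"
        by (simp add: \<mu>.emeasure_eq_measure ennreal_leI)
    qed
    finally show ?thesis
      using q R by (simp add: \<mu>.emeasure_eq_measure del: ennreal_plus)
  qed
  have 3: "measure \<nu> ?B \<le> measure \<nu> A"
    using A s\<nu> by (intro \<nu>.finite_measure_mono) auto
  show "measure \<mu> A - measure \<nu> A \<le> ?s + \<delta>" using 1 2 3 by linarith
qed

end

section \<open>Compactly supported smooth densities\<close>

context
  fixes \<mu> \<nu> :: "'a::euclidean_space measure"
  assumes \<mu>: "prob_dist \<mu>" and \<nu>: "prob_dist \<nu>"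
    and \<mu>m: "integrable \<mu> norm" and \<nu>m: "integrable \<nu> norm"
begin

text \<open>For \<open>b > 0\<close> the half-space itself misses the open ball of radius
  \<open>\<bar>b\<bar>\<close>; otherwise its complement does, and passing to complements only
  changes the sign of the difference of two probabilities.\<close>

lemma abs_half_space_le_tail:
  assumes v: "norm v \<le> 1"
  shows "\<bar>measure \<mu> {x. x \<bullet> v \<ge> b} - measure \<nu> {x. x \<bullet> v \<ge> b}\<bar>
    \<le> measure \<mu> {x. norm x \<ge> \<bar>b\<bar>} + measure \<nu> {x. norm x \<ge> \<bar>b\<bar>}"
proof -
  have ip: "\<bar>x \<bullet> v\<bar> \<le> norm x" for x
    using Cauchy_Schwarz_ineq2[of x v] mult_left_mono[OF v norm_ge_zero[of x]] by simp
  have tail: "measure M A \<le> measure M {x. norm x \<ge> \<bar>b\<bar>}"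
    if M: "prob_dist M" and A: "A \<subseteq> {x. norm x \<ge> \<bar>b\<bar>}" for M :: "'a measure" and A
  proof -
    interpret finite_measure M using M by (rule prob_dist_finite)
    have "{x::'a. norm x \<ge> \<bar>b\<bar>} \<in> sets borel" by measurable
    then show ?thesis using M A by (intro finite_measure_mono) (auto simp: prob_dist_def)
  qed
  show ?thesis
  proof (cases "b > 0")
    case True
    have sub: "{x. x \<bullet> v \<ge> b} \<subseteq> {x. norm x \<ge> \<bar>b\<bar>}"
      using True ip by (auto intro: order_trans[OF _ ip] simp: abs_le_iff)
    then show ?thesis
      using tail[OF \<mu> sub] tail[OF \<nu> sub]
        measure_nonneg[of \<mu> "{x. x \<bullet> v \<ge> b}"] measure_nonneg[of \<nu> "{x. x \<bullet> v \<ge> b}"] by linarith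
  next
    case False
    have "norm x \<ge> \<bar>b\<bar>" if "x \<bullet> v < b" for x
      using False that ip[of x] by linarith
    then have sub: "{x. x \<bullet> v < b} \<subseteq> {x. norm x \<ge> \<bar>b\<bar>}" by blast
    then show ?thesis
      unfolding measure_half_space_compl[OF \<mu>] measure_half_space_compl[OF \<nu>]
      using tail[OF \<mu> sub] tail[OF \<nu> sub]
        measure_nonneg[of \<mu> "{x. x \<bullet> v < b}"] measure_nonneg[of \<nu> "{x. x \<bullet> v < b}"] by linarith
  qed
qed

text \<open>Where the two classes meet: each supplies only its tail \<open>\<delta>\<close>, profile
  norm \<open>W\<close> and high-frequency energy \<open>h\<close>. The Sobolev class takes
  \<open>R = 1\<close> and optimises \<open>T\<close>, the mixtures take
  \<open>T = R\<close>.\<close>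

lemma total_variation_le_truncated:
  assumes R: "R \<ge> 0" and T: "T > 0" and \<delta>: "measure \<mu> (- cball 0 R) \<le> \<delta>"
    and W: "\<And>v. norm v \<le> 1 \<Longrightarrow>
      (LINT b|lborel. \<bar>measure \<mu> {x. x \<bullet> v \<ge> b} - measure \<nu> {x. x \<bullet> v \<ge> b}\<bar>) \<le> W"
    and h: "(\<integral>\<^sup>+\<omega>. ennreal ((cmod (ft \<mu> (\<lambda>_. 1) \<omega> - ft \<nu> (\<lambda>_. 1) \<omega>))\<^sup>2) * indicator (- cball 0 T) \<omega> \<partial>lborel)
      \<le> ennreal h" and h0: "h \<ge> 0"
  shows "total_variation \<mu> \<nu> \<le> sqrt (unit_ball_vol (real DIM('a)) * (R + 1) ^ DIM('a) *
      (2 ^ DIM('a) * unit_ball_vol (real DIM('a)) * 8 * pi * exp 2 * T ^ (DIM('a) + 1)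
        * (perceptron_discrepancy \<mu> \<nu> * W) + h)) + \<delta>"
proof (rule total_variation_le_ft_diff[OF \<mu> \<nu> R \<delta>])
  have ps: "prob_space \<mu>" "sets \<mu> = sets borel" "prob_space \<nu>" "sets \<nu> = sets borel"
    using \<mu> \<nu> by (auto simp: prob_dist_def)
  note A = ps(1,2) \<mu>m ps(3,4) \<nu>m
  note pd = profile_def[OF A] and fd = ft_diff_def[OF A]
  let ?D = "perceptron_discrepancy \<mu> \<nu>"
  let ?K = "2 ^ DIM('a) * unit_ball_vol (real DIM('a)) * 8 * pi * exp 2 * T ^ (DIM('a) + 1) * (?D * W)"
  let ?f = "\<lambda>\<omega>. ennreal ((cmod (ft \<mu> (\<lambda>_. 1) \<omega> - ft \<nu> (\<lambda>_. 1) \<omega>))\<^sup>2)"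
  have low: "(\<integral>\<^sup>+\<omega>. ?f \<omega> * indicator (cball 0 T) \<omega> \<partial>lborel) \<le> ennreal ?K"
    using ft_diff_low_frequency[OF A T, of ?D W] abs_half_space_le_perceptron_discrepancy[OF \<mu> \<nu>] W
    unfolding pd fd by blast
  have "0 \<le> (LINT b|lborel. \<bar>measure \<mu> {x. x \<bullet> 0 \<ge> b} - measure \<nu> {x. x \<bullet> 0 \<ge> b}\<bar>)" by simp
  also have "\<dots> \<le> W" by (rule W) simp
  finally have W0: "W \<ge> 0" .
  have K0: "?K \<ge> 0"
    using W0 T perceptron_discrepancy_nonneg[OF \<mu> \<nu>] by (intro mult_nonneg_nonneg) auto
  then show "0 \<le> ?K + h" using h0 by simp
  have [measurable]: "?f \<in> borel_measurable borel"
    using ft_diff_measurable[OF A] unfolding fd[abs_def] by measurable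
  have mi: "(\<lambda>\<omega>. ?f \<omega> * indicator A \<omega>) \<in> borel_measurable lborel" if [measurable]: "A \<in> sets borel" for A
    by measurable
  have "(\<integral>\<^sup>+\<omega>. ?f \<omega> \<partial>lborel) =
     (\<integral>\<^sup>+\<omega>. ?f \<omega> * indicator (cball 0 T) \<omega> + ?f \<omega> * indicator (- cball 0 T) \<omega> \<partial>lborel)"
    by (intro nn_integral_cong) (auto split: split_indicator)
  also have "\<dots> = (\<integral>\<^sup>+\<omega>. ?f \<omega> * indicator (cball 0 T) \<omega> \<partial>lborel)
      + (\<integral>\<^sup>+\<omega>. ?f \<omega> * indicator (- cball 0 T) \<omega> \<partial>lborel)"
    by (intro nn_integral_add mi) simp_all
  also have "\<dots> \<le> ennreal ?K + ennreal h" by (intro add_mono low h)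
  also have "\<dots> = ennreal (?K + h)" using K0 h0 by (simp only: ennreal_plus)
  finally show "(\<integral>\<^sup>+\<omega>. ?f \<omega> \<partial>lborel) \<le> ennreal (?K + h)" .
qed

end

section \<open>Sobolev classes: high frequencies and choice of the cut-off\<close>

lemma ft_density:
  fixes p :: "'a::euclidean_space \<Rightarrow> real"
  assumes "is_density \<mu> p"
  shows "ft \<mu> (\<lambda>_. 1) = fourier p"
proof
  fix \<omega> :: 'a
  have p: "p \<in> borel_measurable borel" "\<And>x. 0 \<le> p x" "\<mu> = density lborel (\<lambda>x. ennreal (p x))"
    using assms by (auto simp: is_density_def)
  have "ft \<mu> (\<lambda>_. 1) \<omega> = (LINT x|lborel. p x *\<^sub>R (exp (- \<i> * of_real (x \<bullet> \<omega>)) * of_real 1))"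
    unfolding ft_def p(3) using p(1,2) by (intro integral_density) auto
  then show "ft \<mu> (\<lambda>_. 1) \<omega> = fourier p \<omega>"
    by (simp add: fourier_def scaleR_conv_of_real mult.commute)
qed

lemma smooth_classD:
  fixes \<mu> :: "'a::euclidean_space measure"
  assumes "\<mu> \<in> smooth_class \<beta>"
  shows "prob_dist \<mu>" "AE x in \<mu>. x \<in> cball 0 1" "integrable \<mu> norm"
    and "(\<integral>\<^sup>+\<omega>. ennreal (norm \<omega> powr (2 * \<beta>) * (cmod (ft \<mu> (\<lambda>_. 1) \<omega>))\<^sup>2) \<partial>lborel)
      = ennreal ((measure_sobolev_norm \<beta> \<mu>)\<^sup>2)"
proof -
  show pd: "prob_dist \<mu>" using assms by (simp add: smooth_class_def)
  then have s: "sets \<mu> = sets borel" by (simp add: prob_dist_def)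
  show AE: "AE x in \<mu>. x \<in> cball 0 1"
    using assms by (intro AE_msupport s) (auto simp: smooth_class_def)
  interpret finite_measure \<mu> using pd by (rule prob_dist_finite)
  have "(norm :: 'a \<Rightarrow> real) \<in> borel_measurable \<mu>" unfolding measurable_cong_sets[OF s refl] by simp
  then show "integrable \<mu> norm"
    using AE by (intro integrable_const_bound[where B=1]) auto
  obtain p where p: "is_density \<mu> p" "sobolev_energy \<beta> p < \<infinity>"
    using assms by (auto simp: smooth_class_def)
  have "ennreal ((measure_sobolev_norm \<beta> \<mu>)\<^sup>2) = ennreal (enn2real (sobolev_energy \<beta> p))"
    unfolding measure_sobolev_norm_density[OF p(1)] sobolev_norm_def by simp
  \<comment> \<open>Finiteness matters here: \<open>enn2real\<close> would send an infinite energy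
    to 0.\<close>
  also have "\<dots> = sobolev_energy \<beta> p" using p(2) by (intro ennreal_enn2real) simp
  finally show "(\<integral>\<^sup>+\<omega>. ennreal (norm \<omega> powr (2 * \<beta>) * (cmod (ft \<mu> (\<lambda>_. 1) \<omega>))\<^sup>2) \<partial>lborel)
      = ennreal ((measure_sobolev_norm \<beta> \<mu>)\<^sup>2)"
    unfolding sobolev_energy_def ft_density[OF p(1)] ..
qed

lemma cmod_diff_square_le: "(cmod (a - b))\<^sup>2 \<le> 2 * ((cmod a)\<^sup>2 + (cmod b)\<^sup>2)"
proof -
  have "(cmod (a - b))\<^sup>2 \<le> (cmod a + cmod b)\<^sup>2"
    by (intro power_mono norm_triangle_ineq4) simp
  also have "\<dots> \<le> 2 * ((cmod a)\<^sup>2 + (cmod b)\<^sup>2)"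
    using sum_squares_bound[of "cmod a" "cmod b"] by (simp add: power2_sum)
  finally show ?thesis .
qed

text \<open>Outside the ball of radius \<open>T\<close> the weight
  \<open>(norm \<omega> / T) powr (2 * \<beta>)\<close> is at least 1 and can be inserted; the
  factor 2 comes from splitting the squared difference.\<close>

lemma high_frequency_sobolev:
  fixes \<mu> \<nu> :: "'a::euclidean_space measure"
  assumes \<mu>: "\<mu> \<in> smooth_class \<beta>" and \<nu>: "\<nu> \<in> smooth_class \<beta>" and \<beta>: "\<beta> > 0" and T: "T > 0"
  shows "(\<integral>\<^sup>+\<omega>. ennreal ((cmod (ft \<mu> (\<lambda>_. 1) \<omega> - ft \<nu> (\<lambda>_. 1) \<omega>))\<^sup>2) * indicator (- cball 0 T) \<omega> \<partial>lborel)
    \<le> ennreal (2 * T powr (- 2 * \<beta>) * ((measure_sobolev_norm \<beta> \<mu>)\<^sup>2 + (measure_sobolev_norm \<beta> \<nu>)\<^sup>2))"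
proof -
  note D\<mu> = smooth_classD[OF \<mu>] and D\<nu> = smooth_classD[OF \<nu>]
  let ?e = "\<lambda>M \<omega>. norm \<omega> powr (2 * \<beta>) * (cmod (ft M (\<lambda>_. 1) \<omega>))\<^sup>2"
  have m: "ft M (\<lambda>_. 1) \<in> borel_measurable borel" if "prob_dist M" for M :: "'a measure"
  proof -
    interpret finite_measure M using that by (rule prob_dist_finite)
    show ?thesis
      using that by (intro ft_measurable sigma_finite_measure_axioms) (auto simp: prob_dist_def)
  qed
  note [measurable] = m[OF D\<mu>(1)] m[OF D\<nu>(1)]
  have "(\<integral>\<^sup>+\<omega>. ennreal ((cmod (ft \<mu> (\<lambda>_. 1) \<omega> - ft \<nu> (\<lambda>_. 1) \<omega>))\<^sup>2) * indicator (- cball 0 T) \<omega> \<partial>lborel)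
     \<le> (\<integral>\<^sup>+\<omega>. ennreal (2 * T powr (- 2 * \<beta>)) * (ennreal (?e \<mu> \<omega>) + ennreal (?e \<nu> \<omega>)) \<partial>lborel)"
  proof (intro nn_integral_mono)
    fix \<omega> :: 'a
    show "ennreal ((cmod (ft \<mu> (\<lambda>_. 1) \<omega> - ft \<nu> (\<lambda>_. 1) \<omega>))\<^sup>2) * indicator (- cball 0 T) \<omega>
      \<le> ennreal (2 * T powr (- 2 * \<beta>)) * (ennreal (?e \<mu> \<omega>) + ennreal (?e \<nu> \<omega>))"
    proof (cases "\<omega> \<in> cball 0 T")
      case False
      then have "T powr (2 * \<beta>) \<le> norm \<omega> powr (2 * \<beta>)" using \<beta> T by (intro powr_mono2) auto
      then have "T powr (2 * \<beta>) * T powr (- 2 * \<beta>) \<le> norm \<omega> powr (2 * \<beta>) * T powr (- 2 * \<beta>)"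
        by (intro mult_right_mono) auto
      then have 1: "1 \<le> T powr (- 2 * \<beta>) * norm \<omega> powr (2 * \<beta>)"
        using T by (simp add: powr_add[symmetric] mult.commute)
      have "(cmod (ft \<mu> (\<lambda>_. 1) \<omega> - ft \<nu> (\<lambda>_. 1) \<omega>))\<^sup>2 \<le> 1 * (2 * ((cmod (ft \<mu> (\<lambda>_. 1) \<omega>))\<^sup>2 + (cmod (ft \<nu> (\<lambda>_. 1) \<omega>))\<^sup>2))"
        using cmod_diff_square_le by simp
      also have "\<dots> \<le> (T powr (- 2 * \<beta>) * norm \<omega> powr (2 * \<beta>)) * (2 * ((cmod (ft \<mu> (\<lambda>_. 1) \<omega>))\<^sup>2 + (cmod (ft \<nu> (\<lambda>_. 1) \<omega>))\<^sup>2))"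
        by (intro mult_right_mono 1) auto
      also have "\<dots> = 2 * T powr (- 2 * \<beta>) * (?e \<mu> \<omega> + ?e \<nu> \<omega>)" by (simp add: algebra_simps)
      finally show ?thesis
        using False by (simp add: ennreal_mult[symmetric] ennreal_plus[symmetric] ennreal_leI del: ennreal_plus)
    qed simp
  qed
  also have "\<dots> = ennreal (2 * T powr (- 2 * \<beta>)) *
      ((\<integral>\<^sup>+\<omega>. ennreal (?e \<mu> \<omega>) \<partial>lborel) + (\<integral>\<^sup>+\<omega>. ennreal (?e \<nu> \<omega>) \<partial>lborel))"
    by (subst nn_integral_cmult, measurable) (subst nn_integral_add, measurable)
  also have "\<dots> = ennreal (2 * T powr (- 2 * \<beta>) * ((measure_sobolev_norm \<beta> \<mu>)\<^sup>2 + (measure_sobolev_norm \<beta> \<nu>)\<^sup>2))"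
    unfolding D\<mu>(4) D\<nu>(4) by (simp add: ennreal_mult ennreal_plus[symmetric] del: ennreal_plus)
  finally show ?thesis .
qed

text \<open>Support in the unit ball allows \<open>R = 1\<close> and \<open>\<delta> = 0\<close>,
  and profiles vanish for \<open>\<bar>b\<bar> > 1\<close>, so \<open>W\<close> is twice the
  discrepancy. In \<open>C\<close>, the outer \<open>2 ^ DIM('a)\<close> is
  \<open>(R + 1) ^ DIM('a)\<close>, 16 is the earlier 8 doubled by \<open>W\<close>, and the added 2
  is the constant of the high-frequency bound.\<close>

lemma smooth_class_truncated_bound:
  fixes \<mu> \<nu> :: "'a::euclidean_space measure"
  assumes \<mu>: "\<mu> \<in> smooth_class \<beta>" and \<nu>: "\<nu> \<in> smooth_class \<beta>" and \<beta>: "\<beta> > 0" and T: "T > 0"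
  defines "u \<equiv> unit_ball_vol (real DIM('a))"
  defines "C \<equiv> u * 2 ^ DIM('a) * (2 ^ DIM('a) * u * 16 * pi * exp 2 + 2)"
  shows "(total_variation \<mu> \<nu>)\<^sup>2 \<le> C * (T powr (real DIM('a) + 1) * (perceptron_discrepancy \<mu> \<nu>)\<^sup>2
     + T powr (- 2 * \<beta>) * ((measure_sobolev_norm \<beta> \<mu>)\<^sup>2 + (measure_sobolev_norm \<beta> \<nu>)\<^sup>2))"
proof -
  note D\<mu> = smooth_classD[OF \<mu>] and D\<nu> = smooth_classD[OF \<nu>]
  let ?d = "perceptron_discrepancy \<mu> \<nu>"
  let ?S = "(measure_sobolev_norm \<beta> \<mu>)\<^sup>2 + (measure_sobolev_norm \<beta> \<nu>)\<^sup>2"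
  let ?F = "\<lambda>v b. measure \<mu> {x. x \<bullet> v \<ge> b} - measure \<nu> {x. x \<bullet> v \<ge> b}"
  have u0: "u \<ge> 0" unfolding u_def by simp
  have d0: "?d \<ge> 0" by (rule perceptron_discrepancy_nonneg[OF D\<mu>(1) D\<nu>(1)])
  have zero: "measure M A = 0" if "prob_dist M" "AE x in M. x \<in> cball 0 1" "A \<inter> cball 0 1 = {}" "A \<in> sets borel"
    for M and A :: "'a set"
  proof -
    have "AE x in M. x \<notin> A" using that(2) by eventually_elim (use that(3) in auto)
    then have "A \<in> null_sets M" using that(1,4) AE_iff_null_sets[of A M] by (simp add: prob_dist_def)
    then show ?thesis by (simp add: null_sets_def measure_def)
  qed
  have "total_variation \<mu> \<nu> \<le> sqrt (unit_ball_vol (real DIM('a)) * (1 + 1) ^ DIM('a) *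
      (2 ^ DIM('a) * unit_ball_vol (real DIM('a)) * 8 * pi * exp 2 * T ^ (DIM('a) + 1) * (?d * (2 * ?d))
        + 2 * T powr (- 2 * \<beta>) * ?S)) + 0"
  proof (rule total_variation_le_truncated[OF D\<mu>(1) D\<nu>(1) D\<mu>(3) D\<nu>(3) _ T _ _ high_frequency_sobolev[OF \<mu> \<nu> \<beta> T]])
    show "measure \<mu> (- cball 0 1) \<le> 0"
      using zero[OF D\<mu>(1,2), of "- cball 0 1"] by simp
    fix v :: 'a assume v: "norm v \<le> 1"
    have b: "\<bar>?F v b\<bar> \<le> ?d * indicator {-1..1} b" for b
    proof (cases "\<bar>b\<bar> \<le> 1")
      case True
      then show ?thesis
        using abs_half_space_le_perceptron_discrepancy[OF D\<mu>(1) D\<nu>(1), of b v] by (simp add: abs_le_iff)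
    next
      case False
      have A: "{x. norm x \<ge> \<bar>b\<bar>} \<inter> cball (0::'a) 1 = {}" using False by auto
      have "{x::'a. norm x \<ge> \<bar>b\<bar>} \<in> sets borel" by measurable
      then have "\<bar>?F v b\<bar> \<le> 0"
        using abs_half_space_le_tail[OF D\<mu>(1) D\<nu>(1) D\<mu>(3) D\<nu>(3) v, of b] zero[OF D\<mu>(1,2) A] zero[OF D\<nu>(1,2) A] by simp
      also have "0 \<le> ?d * indicator {-1..1} b" using d0 by simp
      finally show ?thesis .
    qed
    have "integrable lborel (\<lambda>b. ?d * indicator {-1..1::real} b)"
      by (intro integrable_mult_right integrable_real_indicator) (auto simp: emeasure_lborel_Icc_eq)
    then have "(LINT b|lborel. \<bar>?F v b\<bar>) \<le> (LINT b|lborel. ?d * indicator {-1..1::real} b)"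
      by (rule integral_mono') (use b d0 in auto)
    then show "(LINT b|lborel. \<bar>?F v b\<bar>) \<le> 2 * ?d" by simp
  qed auto
  also have "\<dots> = sqrt (u * 2 ^ DIM('a) * (2 ^ DIM('a) * u * 16 * pi * exp 2 * (T powr (real DIM('a) + 1) * ?d\<^sup>2)
      + 2 * (T powr (- 2 * \<beta>) * ?S)))"
  proof -
    have "T powr (real DIM('a) + 1) = T ^ (DIM('a) + 1)"
      using powr_realpow[OF T, of "DIM('a) + 1"] by (simp add: add.commute)
    then show ?thesis by (simp add: u_def power2_eq_square mult_ac)
  qed
  also have "\<dots> \<le> sqrt (C * (T powr (real DIM('a) + 1) * ?d\<^sup>2 + T powr (- 2 * \<beta>) * ?S))"
  proof (rule real_sqrt_le_mono)
    let ?k = "2 ^ DIM('a) * u * 16 * pi * exp 2"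
    have "?k * (T powr (real DIM('a) + 1) * ?d\<^sup>2) + 2 * (T powr (- 2 * \<beta>) * ?S)
      \<le> (?k + 2) * (T powr (real DIM('a) + 1) * ?d\<^sup>2) + (?k + 2) * (T powr (- 2 * \<beta>) * ?S)"
      using u0 by (intro add_mono mult_right_mono) auto
    also have "\<dots> = (?k + 2) * (T powr (real DIM('a) + 1) * ?d\<^sup>2 + T powr (- 2 * \<beta>) * ?S)"
      by (simp only: distrib_left)
    finally have "u * 2 ^ DIM('a) * (?k * (T powr (real DIM('a) + 1) * ?d\<^sup>2) + 2 * (T powr (- 2 * \<beta>) * ?S))
      \<le> u * 2 ^ DIM('a) * ((?k + 2) * (T powr (real DIM('a) + 1) * ?d\<^sup>2 + T powr (- 2 * \<beta>) * ?S))"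
      using u0 by (intro mult_left_mono) auto
    then show "u * 2 ^ DIM('a) * (?k * (T powr (real DIM('a) + 1) * ?d\<^sup>2) + 2 * (T powr (- 2 * \<beta>) * ?S))
      \<le> C * (T powr (real DIM('a) + 1) * ?d\<^sup>2 + T powr (- 2 * \<beta>) * ?S)"
      unfolding C_def by (simp only: mult.assoc)
  qed
  finally have "total_variation \<mu> \<nu> \<le> sqrt (C * (T powr (real DIM('a) + 1) * ?d\<^sup>2 + T powr (- 2 * \<beta>) * ?S))" .
  then have "(total_variation \<mu> \<nu>)\<^sup>2 \<le> (sqrt (C * (T powr (real DIM('a) + 1) * ?d\<^sup>2 + T powr (- 2 * \<beta>) * ?S)))\<^sup>2"
    using total_variation_nonneg[OF D\<mu>(1) D\<nu>(1)] by (intro power_mono) auto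
  also have "\<dots> = C * (T powr (real DIM('a) + 1) * ?d\<^sup>2 + T powr (- 2 * \<beta>) * ?S)"
    using u0 unfolding C_def by (intro real_sqrt_pow2 mult_nonneg_nonneg add_nonneg_nonneg) auto
  finally show ?thesis .
qed

text \<open>With \<open>k = 2 * \<beta> + m\<close>, the two terms agree when
  \<open>T powr k\<close> is \<open>S / \<delta>\<^sup>2\<close>; both are then
  \<open>S powr (m / k) * \<delta> powr (4 * \<beta> / k)\<close>. Raising to the power
  \<open>k / (4 * \<beta>)\<close> makes the bound linear in \<open>\<delta>\<close>.\<close>

lemma interpolation_optimize:
  fixes \<tau> \<delta> S C m \<beta> :: real
  assumes \<tau>: "\<tau> \<ge> 0" and \<delta>: "\<delta> \<ge> 0" and S: "S \<ge> 0" and C: "C \<ge> 0" and m: "m > 0" and \<beta>: "\<beta> > 0"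
    and b: "\<And>T. T > 0 \<Longrightarrow> \<tau>\<^sup>2 \<le> C * (T powr m * \<delta>\<^sup>2 + T powr (- 2 * \<beta>) * S)"
  shows "\<tau> powr ((2 * \<beta> + m) / (2 * \<beta>)) \<le> (2 * C) powr ((2 * \<beta> + m) / (4 * \<beta>)) * S powr (m / (4 * \<beta>)) * \<delta>"
proof (cases "\<delta> = 0 \<or> S = 0")
  \<comment> \<open>No balancing \<open>T\<close> exists here. Instead \<open>T\<close> tends to
    infinity if \<open>\<delta> = 0\<close> and to 0 if \<open>S = 0\<close>; either way
    \<open>\<tau> = 0\<close>, and \<open>powr\<close> of 0 is 0.\<close>
  case True
  have "\<tau>\<^sup>2 \<le> 0"
  proof (cases "\<delta> = 0")
    case True
    have "((\<lambda>T. C * (T powr (- 2 * \<beta>) * S)) \<longlongrightarrow> C * (0 * S)) at_top"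
      using \<beta> by (intro tendsto_intros tendsto_neg_powr filterlim_ident) auto
    moreover have "eventually (\<lambda>T. \<tau>\<^sup>2 \<le> C * (T powr (- 2 * \<beta>) * S)) at_top"
      using eventually_gt_at_top[of 0] by eventually_elim (use b True in auto)
    ultimately have "\<tau>\<^sup>2 \<le> C * (0 * S)"
      by (intro tendsto_lowerbound[where F=at_top and f="\<lambda>T. C * (T powr (- 2 * \<beta>) * S)"]) auto
    then show ?thesis by simp
  next
    case False
    then have S0: "S = 0" using True by simp
    \<comment> \<open>Replacing \<open>T\<close> by \<open>1 / T\<close> turns the limit at 0 into
      one at infinity.\<close>
    have "((\<lambda>T. C * (T powr (- m) * \<delta>\<^sup>2)) \<longlongrightarrow> C * (0 * \<delta>\<^sup>2)) at_top"
      using m by (intro tendsto_intros tendsto_neg_powr filterlim_ident) auto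
    moreover have "eventually (\<lambda>T. \<tau>\<^sup>2 \<le> C * (T powr (- m) * \<delta>\<^sup>2)) at_top"
      using eventually_gt_at_top[of 0]
    proof eventually_elim
      case (elim T)
      have "(1 / T) powr m = T powr (- m)" using elim by (simp add: powr_minus powr_divide inverse_eq_divide)
      then show ?case using b[of "1 / T"] elim S0 by simp
    qed
    ultimately have "\<tau>\<^sup>2 \<le> C * (0 * \<delta>\<^sup>2)"
      by (intro tendsto_lowerbound[where F=at_top and f="\<lambda>T. C * (T powr (- m) * \<delta>\<^sup>2)"]) auto
    then show ?thesis by simp
  qed
  then have "\<tau> = 0" by simp
  then show ?thesis using \<delta> by simp
next
  case False
  then have pos: "\<delta> > 0" "S > 0" using \<delta> S by auto
  define k where "k = 2 * \<beta> + m"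
  have k: "k > 0" using \<beta> m by (simp add: k_def)
  define T where "T = (S / \<delta>\<^sup>2) powr (1 / k)"
  have T: "T > 0" using pos by (simp add: T_def)
  have Tp: "T powr a = S powr (a / k) * \<delta> powr (- 2 * a / k)" for a
  proof -
    have "(\<delta>\<^sup>2) powr (a / k) = (\<delta> powr 2) powr (a / k)" using pos by simp
    also have "\<dots> = \<delta> powr (2 * a / k)" by (simp only: powr_powr times_divide_eq_right)
    finally have "(\<delta>\<^sup>2) powr (a / k) = \<delta> powr (2 * a / k)" .
    then show ?thesis
      unfolding T_def using pos by (simp add: powr_powr powr_divide powr_minus_divide)
  qed
  have "\<delta>\<^sup>2 = \<delta> powr 2" using pos by simp
  then have "T powr m * \<delta>\<^sup>2 = S powr (m / k) * \<delta> powr (- 2 * m / k + 2)"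
    unfolding Tp by (simp only: powr_add mult.assoc)
  also have "- 2 * m / k + 2 = 4 * \<beta> / k" using k by (simp add: k_def field_simps)
  finally have e1: "T powr m * \<delta>\<^sup>2 = S powr (m / k) * \<delta> powr (4 * \<beta> / k)" .
  have "T powr (- 2 * \<beta>) * S = T powr (- 2 * \<beta>) * S powr 1" using pos by simp
  also have "\<dots> = S powr (- 2 * \<beta> / k + 1) * \<delta> powr (- 2 * (- 2 * \<beta>) / k)"
    unfolding Tp by (simp only: powr_add mult_ac)
  also have "- 2 * \<beta> / k + 1 = m / k" using k by (simp add: k_def field_simps)
  also have "- 2 * (- 2 * \<beta>) / k = 4 * \<beta> / k" by simp
  finally have e2: "T powr (- 2 * \<beta>) * S = S powr (m / k) * \<delta> powr (4 * \<beta> / k)" .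
  have "\<tau>\<^sup>2 \<le> 2 * C * (S powr (m / k) * \<delta> powr (4 * \<beta> / k))"
    using b[OF T] unfolding e1 e2 by simp
  then have "(\<tau>\<^sup>2) powr (k / (4 * \<beta>)) \<le> (2 * C * (S powr (m / k) * \<delta> powr (4 * \<beta> / k))) powr (k / (4 * \<beta>))"
    using k \<beta> by (intro powr_mono2) auto
  also have "\<dots> = (2 * C) powr (k / (4 * \<beta>)) * ((S powr (m / k)) powr (k / (4 * \<beta>)) * (\<delta> powr (4 * \<beta> / k)) powr (k / (4 * \<beta>)))"
    using C by (simp add: powr_mult)
  also have "\<dots> = (2 * C) powr (k / (4 * \<beta>)) * (S powr (m / (4 * \<beta>)) * \<delta>)"
    using k \<beta> pos by (simp add: powr_powr)
  also have "(\<tau>\<^sup>2) powr (k / (4 * \<beta>)) = \<tau> powr (k / (2 * \<beta>))"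
  proof (cases "\<tau> = 0")
    case False
    then have "\<tau>\<^sup>2 = \<tau> powr 2" using \<tau> by simp
    then show ?thesis by (simp add: powr_powr)
  qed simp
  finally show ?thesis unfolding k_def by (simp add: mult.assoc)
qed

lemma smooth_class_bound:
  assumes \<beta>: "\<beta> > 0"
  shows "\<exists>C::real. \<forall>\<mu>\<in>smooth_class \<beta>. \<forall>\<nu>\<in>smooth_class \<beta> :: 'a::euclidean_space measure set.
        total_variation \<mu> \<nu> powr ((2 * \<beta> + real DIM('a) + 1) / (2 * \<beta>))
        \<le> C * ((measure_sobolev_norm \<beta> \<mu>)\<^sup>2 + (measure_sobolev_norm \<beta> \<nu>)\<^sup>2)
                powr ((real DIM('a) + 1) / (4 * \<beta>))
            * perceptron_discrepancy \<mu> \<nu>"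
proof -
  let ?u = "unit_ball_vol (real DIM('a))"
  let ?C = "?u * 2 ^ DIM('a) * (2 ^ DIM('a) * ?u * 16 * pi * exp 2 + 2)"
  show ?thesis
  proof (intro exI ballI)
    fix \<mu> \<nu> :: "'a measure" assume \<mu>\<nu>: "\<mu> \<in> smooth_class \<beta>" "\<nu> \<in> smooth_class \<beta>"
    note p = smooth_classD(1)[OF \<mu>\<nu>(1)] smooth_classD(1)[OF \<mu>\<nu>(2)]
    show "total_variation \<mu> \<nu> powr ((2 * \<beta> + real DIM('a) + 1) / (2 * \<beta>))
        \<le> (2 * ?C) powr ((2 * \<beta> + (real DIM('a) + 1)) / (4 * \<beta>)) * ((measure_sobolev_norm \<beta> \<mu>)\<^sup>2 + (measure_sobolev_norm \<beta> \<nu>)\<^sup>2)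
                powr ((real DIM('a) + 1) / (4 * \<beta>))
            * perceptron_discrepancy \<mu> \<nu>"
      unfolding add.assoc[of "2 * \<beta>"]
      by (rule interpolation_optimize[OF total_variation_nonneg[OF p] perceptron_discrepancy_nonneg[OF p] _ _ _ \<beta>
            smooth_class_truncated_bound[OF \<mu>\<nu> \<beta>]]) auto
  qed
qed

section \<open>Gaussian mixtures\<close>

lemma gauss_kernel_1_eq:
  fixes z :: "'a::euclidean_space"
  shows "gauss_kernel 1 z = (2 * pi) powr (- real DIM('a) / 2) * exp (- (norm z)\<^sup>2 / 2)"
proof -
  have "gauss_kernel 1 z = (\<Prod>b\<in>(Basis::'a set). 1 / sqrt (2 * pi)) * (\<Prod>b\<in>Basis. exp (- (z \<bullet> b)\<^sup>2 / 2))"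
    unfolding gauss_kernel_def by (simp add: normal_density_def prod_dividef power_divide)
  also have "(\<Prod>b\<in>Basis. exp (- (z \<bullet> b)\<^sup>2 / 2)) = exp (- (norm z)\<^sup>2 / 2)"
  proof -
    have "(norm z)\<^sup>2 = (\<Sum>b\<in>Basis. (z \<bullet> b)\<^sup>2)"
      unfolding power2_norm_eq_inner by (subst euclidean_inner) (simp add: power2_eq_square)
    then have "- (norm z)\<^sup>2 / 2 = (\<Sum>b\<in>Basis. - (z \<bullet> b)\<^sup>2 / 2)"
      by (simp add: sum_negf sum_divide_distrib)
    then show ?thesis by (simp only: exp_sum[OF finite_Basis])
  qed
  also have "(\<Prod>b\<in>(Basis::'a set). 1 / sqrt (2 * pi)) = (2 * pi) powr (- real DIM('a) / 2)"
  proof -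
    have "1 / sqrt (2 * pi) = (2 * pi) powr (- (1 / 2))"
      by (simp add: powr_minus powr_half_sqrt inverse_eq_divide)
    then have "(\<Prod>b\<in>(Basis::'a set). 1 / sqrt (2 * pi)) = ((2 * pi) powr (- (1 / 2))) ^ DIM('a)"
      by simp
    also have "\<dots> = ((2 * pi) powr (- (1 / 2))) powr (real DIM('a))"
      by (intro powr_realpow[symmetric]) simp
    finally show ?thesis by (simp add: powr_powr)
  qed
  finally show ?thesis .
qed

lemma std_gaussian_eq: "std_gaussian = density lborel (\<lambda>x. ennreal (gauss_kernel 1 x))"
  unfolding std_gaussian_def gauss_kernel_1_eq ..

lemma prob_dist_std_gaussian: "prob_dist (std_gaussian :: 'a::euclidean_space measure)"
  unfolding prob_dist_def std_gaussian_eq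
  by (auto intro!: prob_spaceI simp: emeasure_density nn_integral_gauss_kernel)

lemma ft_std_gaussian: "ft std_gaussian (\<lambda>_. 1) \<omega> = of_real (exp (- (norm \<omega>)\<^sup>2 / 2))"
  for \<omega> :: "'a::euclidean_space"
proof -
  let ?c = "(2 * pi) powr (- real DIM('a) / 2)"
  have "ft std_gaussian (\<lambda>_. 1) \<omega> = (LINT x|lborel. gauss_kernel 1 x *\<^sub>R (exp (- \<i> * of_real (x \<bullet> \<omega>)) * of_real 1))"
    unfolding ft_def std_gaussian_eq by (intro integral_density) (auto simp: gauss_kernel_nonneg)
  also have "\<dots> = (LINT x|lborel. of_real ?c * (exp (- \<i> * of_real (x \<bullet> \<omega>)) * of_real (exp (- (1 * norm x)\<^sup>2 / 2))))"
    unfolding gauss_kernel_1_eq by (intro Bochner_Integration.integral_cong refl) (simp add: scaleR_conv_of_real mult_ac)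
  also have "\<dots> = of_real ?c * ft lborel (\<lambda>x. exp (- (1 * norm x)\<^sup>2 / 2)) \<omega>"
    unfolding ft_def by (rule integral_mult_right_zero)
  also have "\<dots> = of_real (?c * ((2 * pi) ^ DIM('a) * (?c * exp (- (norm \<omega>)\<^sup>2 / 2))))"
    by (subst fourier_gaussian(2)) (simp_all add: gauss_kernel_1_eq)
  \<comment> \<open>One normalising constant comes from the density and one from
    \<open>gauss_kernel_1_eq\<close> on the frequency side; together they cancel the
    \<open>(2 * pi) ^ DIM('a)\<close> of the transform.\<close>
  also have "?c * ((2 * pi) ^ DIM('a) * (?c * exp (- (norm \<omega>)\<^sup>2 / 2))) = exp (- (norm \<omega>)\<^sup>2 / 2)"
  proof -
    have "?c * (2 * pi) ^ DIM('a) * ?c = ?c * (2 * pi) powr (real DIM('a)) * ?c"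
      by (simp add: powr_realpow)
    also have "\<dots> = 1" by (simp only: powr_add[symmetric]) simp
    finally show ?thesis by (simp add: mult.assoc[symmetric])
  qed
  finally show ?thesis .
qed

lemma norm_ft_prob_le_1:
  assumes "prob_dist M"
  shows "cmod (ft M (\<lambda>_. 1) \<omega>) \<le> 1"
proof -
  interpret prob_space M using assms by (simp add: prob_dist_def)
  show ?thesis using norm_ft_le[of M "\<lambda>_. 1" \<omega>] assms by (simp add: prob_dist_def prob_space)
qed

lemma ft_convolution:
  fixes M N :: "'a::ordered_euclidean_space measure"
  assumes M: "prob_dist M" and N: "prob_dist N"
  shows "ft (convolution M N) (\<lambda>_. 1) \<omega> = ft M (\<lambda>_. 1) \<omega> * ft N (\<lambda>_. 1) \<omega>"
proof -
  interpret M: prob_space M using M by (simp add: prob_dist_def)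
  interpret N: prob_space N using N by (simp add: prob_dist_def)
  interpret P: pair_sigma_finite M N ..
  have sM [measurable_cong]: "sets M = sets borel" and sN [measurable_cong]: "sets N = sets borel"
    using M N by (auto simp: prob_dist_def)
  let ?e = "\<lambda>x::'a. exp (- \<i> * of_real (x \<bullet> \<omega>)) * complex_of_real 1"
  have I: "integrable M ?e" "integrable N ?e"
    by (intro integrable_ft sM sN; simp)+
  have "ft (convolution M N) (\<lambda>_. 1) \<omega> = (LINT p|(M \<Otimes>\<^sub>M N). ?e (fst p + snd p))"
    unfolding ft_def convolution_def by (subst integral_distr) (auto simp: case_prod_beta)
  also have "\<dots> = (LINT p|(M \<Otimes>\<^sub>M N). ?e (fst p) * ?e (snd p))"
    by (intro Bochner_Integration.integral_cong refl) (simp add: exp_add[symmetric] inner_add_left algebra_simps)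
  also have "\<dots> = (LINT x|M. LINT y|N. ?e x * ?e y)"
    using P.integral_fst[of "\<lambda>x y. ?e x * ?e y"] integrable_pair_mult[OF P.pair_sigma_finite_axioms I]
    by (simp only: case_prod_unfold)
  also have "\<dots> = ft M (\<lambda>_. 1) \<omega> * ft N (\<lambda>_. 1) \<omega>"
    unfolding ft_def by (simp only: integral_mult_right_zero integral_mult_left_zero)
  finally show ?thesis .
qed

text \<open>A bound for the mean of \<open>exp ((norm x)\<^sup>2 / 8)\<close> valid for all
  mixtures: if \<open>norm x \<le> 1\<close>, then the square of \<open>norm (x + y)\<close> divided
  by 8 is at most \<open>1 / 4 + (norm y)\<^sup>2 / 4\<close>. The rate 1/4 stays below the rate 1/2
  of the Gaussian density, so the integral converges.\<close>

definition gauss_moment :: "'a::euclidean_space itself \<Rightarrow> real" where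
  "gauss_moment _ = exp (1 / 4) * (LINT z|(lborel::'a measure). exp ((norm z)\<^sup>2 / 4) * gauss_kernel 1 z)"

lemma nn_integral_gauss_moment:
  "(\<integral>\<^sup>+z. ennreal (exp (1 / 4) * exp ((norm z)\<^sup>2 / 4)) \<partial>(std_gaussian :: 'a::euclidean_space measure))
    = ennreal (gauss_moment TYPE('a))"
proof -
  let ?c = "(2 * pi) powr (- real DIM('a) / 2)"
  have eq: "exp ((norm z)\<^sup>2 / 4) * gauss_kernel 1 z = ?c * exp (- (sqrt (1 / 2) * norm z)\<^sup>2 / 2)" for z :: 'a
    unfolding gauss_kernel_1_eq by (simp add: power_mult_distrib exp_add[symmetric] power_divide real_sqrt_divide)
  have I: "integrable lborel (\<lambda>z::'a. exp ((norm z)\<^sup>2 / 4) * gauss_kernel 1 z)"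
    unfolding eq by (intro integrable_mult_right fourier_gaussian(1)) simp
  have "(\<integral>\<^sup>+z. ennreal (exp (1 / 4) * exp ((norm z)\<^sup>2 / 4)) \<partial>(std_gaussian :: 'a measure))
    = (\<integral>\<^sup>+z. ennreal (exp (1 / 4) * (exp ((norm z)\<^sup>2 / 4) * gauss_kernel 1 z)) \<partial>(lborel :: 'a measure))"
    unfolding std_gaussian_eq
    by (subst nn_integral_density) (auto simp: ennreal_mult[symmetric] gauss_kernel_nonneg mult_ac)
  also have "\<dots> = ennreal (LINT z|(lborel::'a measure). exp (1 / 4) * (exp ((norm z)\<^sup>2 / 4) * gauss_kernel 1 z))"
    using I by (intro nn_integral_eq_integral integrable_mult_right) (auto simp: gauss_kernel_nonneg)
  finally show ?thesis unfolding gauss_moment_def by (simp only: integral_mult_right_zero)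
qed

lemma gauss_moment_nonneg: "gauss_moment TYPE('a::euclidean_space) \<ge> 0"
  unfolding gauss_moment_def by (auto simp: gauss_kernel_nonneg intro!: mult_nonneg_nonneg integral_nonneg)

lemma gaussian_mixtureD:
  fixes \<mu> :: "'a::ordered_euclidean_space measure"
  assumes "\<mu> \<in> gaussian_mixture_class"
  shows "prob_dist \<mu>" "cmod (ft \<mu> (\<lambda>_. 1) \<omega>) \<le> exp (- (norm \<omega>)\<^sup>2 / 2)"
    and "(\<integral>\<^sup>+x. ennreal (exp ((norm x)\<^sup>2 / 8)) \<partial>\<mu>) \<le> ennreal (gauss_moment TYPE('a))"
proof -
  obtain \<rho> where \<mu>: "\<mu> = convolution \<rho> std_gaussian" and \<rho>: "prob_dist \<rho>" and supp: "msupport \<rho> \<subseteq> cball 0 1"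
    using assms by (auto simp: gaussian_mixture_class_def)
  let ?\<gamma> = "std_gaussian :: 'a measure"
  interpret \<rho>: prob_space \<rho> using \<rho> by (simp add: prob_dist_def)
  interpret \<gamma>: prob_space ?\<gamma> using prob_dist_std_gaussian[where 'a='a] by (simp add: prob_dist_def)
  have s [measurable_cong]: "sets \<rho> = sets borel" "sets ?\<gamma> = sets borel"
    using \<rho> prob_dist_std_gaussian by (auto simp: prob_dist_def)
  interpret P: pair_prob_space \<rho> ?\<gamma> ..
  show "prob_dist \<mu>"
    unfolding \<mu> prob_dist_def convolution_def by (auto intro!: P.prob_space_distr)
  have "cmod (ft \<mu> (\<lambda>_. 1) \<omega>) = cmod (ft \<rho> (\<lambda>_. 1) \<omega>) * exp (- (norm \<omega>)\<^sup>2 / 2)"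
    unfolding \<mu> ft_convolution[OF \<rho> prob_dist_std_gaussian] ft_std_gaussian by (simp add: norm_mult)
  also have "\<dots> \<le> 1 * exp (- (norm \<omega>)\<^sup>2 / 2)"
    by (intro mult_right_mono norm_ft_prob_le_1 \<rho>) simp
  finally show "cmod (ft \<mu> (\<lambda>_. 1) \<omega>) \<le> exp (- (norm \<omega>)\<^sup>2 / 2)" by simp
  have "(\<integral>\<^sup>+x. ennreal (exp ((norm x)\<^sup>2 / 8)) \<partial>\<mu>) = (\<integral>\<^sup>+x. \<integral>\<^sup>+y. ennreal (exp ((norm (x + y))\<^sup>2 / 8)) \<partial>?\<gamma> \<partial>\<rho>)"
    unfolding \<mu> by (intro nn_integral_convolution \<rho>.finite_measure_axioms \<gamma>.finite_measure_axioms s) measurable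
  also have "\<dots> \<le> (\<integral>\<^sup>+x. ennreal (gauss_moment TYPE('a)) \<partial>\<rho>)"
  proof (rule nn_integral_mono_AE)
    have "AE x in \<rho>. x \<in> cball 0 1" by (rule AE_msupport[OF s(1) supp]) simp
    then show "AE x in \<rho>. (\<integral>\<^sup>+y. ennreal (exp ((norm (x + y))\<^sup>2 / 8)) \<partial>?\<gamma>) \<le> ennreal (gauss_moment TYPE('a))"
    proof eventually_elim
      case (elim x)
      have "(norm (x + y))\<^sup>2 / 8 \<le> 1 / 4 + (norm y)\<^sup>2 / 4" for y
      proof -
        have "(norm (x + y))\<^sup>2 \<le> (norm x + norm y)\<^sup>2" by (intro power_mono norm_triangle_ineq) simp
        also have "\<dots> \<le> (1 + norm y)\<^sup>2" using elim by (intro power_mono) auto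
        also have "\<dots> \<le> 2 + 2 * (norm y)\<^sup>2" using sum_squares_bound[of 1 "norm y"] by (simp add: power2_sum)
        finally show ?thesis by simp
      qed
      then have "(\<integral>\<^sup>+y. ennreal (exp ((norm (x + y))\<^sup>2 / 8)) \<partial>?\<gamma>)
        \<le> (\<integral>\<^sup>+y. ennreal (exp (1 / 4) * exp ((norm y)\<^sup>2 / 4)) \<partial>?\<gamma>)"
        by (intro nn_integral_mono ennreal_leI) (simp add: exp_add[symmetric])
      then show ?case unfolding nn_integral_gauss_moment .
    qed
  qed
  also have "\<dots> = ennreal (gauss_moment TYPE('a))" by (simp add: \<rho>.emeasure_space_1)
  finally show "(\<integral>\<^sup>+x. ennreal (exp ((norm x)\<^sup>2 / 8)) \<partial>\<mu>) \<le> ennreal (gauss_moment TYPE('a))" .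
qed

text \<open>Markov's inequality for the exponential moment, uniform over the class.\<close>

lemma gaussian_mixture_tail:
  fixes \<mu> :: "'a::ordered_euclidean_space measure"
  assumes \<mu>: "\<mu> \<in> gaussian_mixture_class" and r: "r \<ge> 0"
  shows "measure \<mu> {x. norm x \<ge> r} \<le> gauss_moment TYPE('a) * exp (- r\<^sup>2 / 8)"
proof -
  interpret prob_space \<mu> using gaussian_mixtureD(1)[OF \<mu>] by (simp add: prob_dist_def)
  have s [measurable_cong]: "sets \<mu> = sets borel" using gaussian_mixtureD(1)[OF \<mu>] by (simp add: prob_dist_def)
  have "{x::'a. norm x \<ge> r} \<in> sets borel" by measurable
  then have "ennreal (measure \<mu> {x. norm x \<ge> r}) = (\<integral>\<^sup>+x. indicator {x. norm x \<ge> r} x \<partial>\<mu>)"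
    using s by (simp add: emeasure_eq_measure)
  also have "\<dots> \<le> (\<integral>\<^sup>+x. ennreal (exp (- r\<^sup>2 / 8)) * ennreal (exp ((norm x)\<^sup>2 / 8)) \<partial>\<mu>)"
  proof (intro nn_integral_mono)
    fix x
    show "indicator {x. norm x \<ge> r} x \<le> ennreal (exp (- r\<^sup>2 / 8)) * ennreal (exp ((norm x)\<^sup>2 / 8))"
    proof (cases "norm x \<ge> r")
      case True
      then have "r\<^sup>2 \<le> (norm x)\<^sup>2" using r by (intro power_mono)
      then have "1 \<le> exp (- r\<^sup>2 / 8) * exp ((norm x)\<^sup>2 / 8)" by (simp add: exp_add[symmetric])
      then show ?thesis using True by (simp add: ennreal_mult[symmetric] del: ennreal_1 add: ennreal_1[symmetric] ennreal_leI)
    qed simp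
  qed
  also have "\<dots> = ennreal (exp (- r\<^sup>2 / 8)) * (\<integral>\<^sup>+x. ennreal (exp ((norm x)\<^sup>2 / 8)) \<partial>\<mu>)"
    by (rule nn_integral_cmult) measurable
  also have "\<dots> \<le> ennreal (exp (- r\<^sup>2 / 8)) * ennreal (gauss_moment TYPE('a))"
    by (intro mult_left_mono gaussian_mixtureD(3)[OF \<mu>]) simp
  finally show ?thesis
    using gauss_moment_nonneg[where 'a='a] by (simp add: ennreal_mult[symmetric] mult.commute)
qed

lemma integrable_norm_gaussian_mixture:
  fixes \<mu> :: "'a::ordered_euclidean_space measure"
  assumes \<mu>: "\<mu> \<in> gaussian_mixture_class"
  shows "integrable \<mu> norm"
proof -
  have s [measurable_cong]: "sets \<mu> = sets borel" using gaussian_mixtureD(1)[OF \<mu>] by (simp add: prob_dist_def)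
  have I: "integrable \<mu> (\<lambda>x. exp ((norm x)\<^sup>2 / 8))"
    using gaussian_mixtureD(3)[OF \<mu>] by (intro integrableI_nonneg) (auto simp: le_less_trans)
  have b: "norm x \<le> 2 * exp ((norm x)\<^sup>2 / 8)" for x :: 'a
  proof -
    \<comment> \<open>This square yields \<open>norm x \<le> 2 + (norm x)\<^sup>2 / 8\<close>, of
      the form needed for \<open>1 + y \<le> exp y\<close> at the exponent 1/8.\<close>
    have "0 \<le> (norm x - 4)\<^sup>2" by simp
    then have "8 * norm x \<le> (norm x)\<^sup>2 + 16" by (simp add: power2_diff)
    moreover have "n \<le> 2 * (1 + t / 8)" if "8 * n \<le> t + 16" "0 \<le> t" for n t :: real
      using that by (simp add: field_simps)
    ultimately have "norm x \<le> 2 * (1 + (norm x)\<^sup>2 / 8)" using zero_le_power2 by blast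
    also have "\<dots> \<le> 2 * exp ((norm x)\<^sup>2 / 8)" by (intro mult_left_mono exp_ge_add_one_self) simp
    finally show ?thesis .
  qed
  show ?thesis
  proof (rule Bochner_Integration.integrable_bound)
    show "integrable \<mu> (\<lambda>x. 2 * exp ((norm x)\<^sup>2 / 8))" using I by simp
    show "(norm :: 'a \<Rightarrow> real) \<in> borel_measurable \<mu>" by measurable
  qed (use b in auto)
qed

lemma gaussian_mixture_high_frequency:
  fixes \<mu> \<nu> :: "'a::ordered_euclidean_space measure"
  assumes \<mu>: "\<mu> \<in> gaussian_mixture_class" and \<nu>: "\<nu> \<in> gaussian_mixture_class" and T: "T > 0"
  shows "(\<integral>\<^sup>+\<omega>. ennreal ((cmod (ft \<mu> (\<lambda>_. 1) \<omega> - ft \<nu> (\<lambda>_. 1) \<omega>))\<^sup>2) * indicator (- cball 0 T) \<omega> \<partial>lborel)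
    \<le> ennreal (4 * exp (- T\<^sup>2 / 2) * (LINT \<omega>|(lborel::'a measure). exp (- (1 * norm \<omega>)\<^sup>2 / 2)))"
proof -
  let ?G = "\<lambda>\<omega>::'a. exp (- (1 * norm \<omega>)\<^sup>2 / 2)"
  have "(\<integral>\<^sup>+\<omega>. ennreal ((cmod (ft \<mu> (\<lambda>_. 1) \<omega> - ft \<nu> (\<lambda>_. 1) \<omega>))\<^sup>2) * indicator (- cball 0 T) \<omega> \<partial>lborel)
     \<le> (\<integral>\<^sup>+\<omega>. ennreal (4 * exp (- T\<^sup>2 / 2) * ?G \<omega>) \<partial>lborel)"
  proof (intro nn_integral_mono)
    fix \<omega> :: 'a
    show "ennreal ((cmod (ft \<mu> (\<lambda>_. 1) \<omega> - ft \<nu> (\<lambda>_. 1) \<omega>))\<^sup>2) * indicator (- cball 0 T) \<omega>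
      \<le> ennreal (4 * exp (- T\<^sup>2 / 2) * ?G \<omega>)"
    proof (cases "\<omega> \<in> cball 0 T")
      case False
      have "cmod (ft \<mu> (\<lambda>_. 1) \<omega> - ft \<nu> (\<lambda>_. 1) \<omega>) \<le> 2 * ?G \<omega>"
        using norm_triangle_ineq4[of "ft \<mu> (\<lambda>_. 1) \<omega>" "ft \<nu> (\<lambda>_. 1) \<omega>"]
          gaussian_mixtureD(2)[OF \<mu>, of \<omega>] gaussian_mixtureD(2)[OF \<nu>, of \<omega>] by simp
      then have "(cmod (ft \<mu> (\<lambda>_. 1) \<omega> - ft \<nu> (\<lambda>_. 1) \<omega>))\<^sup>2 \<le> (2 * ?G \<omega>)\<^sup>2"
        by (intro power_mono) auto
      \<comment> \<open>One Gaussian factor is bounded by its value at radius \<open>T\<close>; the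
        other is kept for integrability.\<close>
      also have "\<dots> = 4 * ?G \<omega> * ?G \<omega>" by (simp add: power2_eq_square)
      also have "\<dots> \<le> 4 * exp (- T\<^sup>2 / 2) * ?G \<omega>"
      proof (intro mult_right_mono mult_left_mono)
        have "T\<^sup>2 \<le> (norm \<omega>)\<^sup>2" using False T by (intro power_mono) auto
        then show "?G \<omega> \<le> exp (- T\<^sup>2 / 2)" by simp
      qed auto
      finally show ?thesis using False by (simp add: ennreal_leI)
    qed simp
  qed
  also have "\<dots> = ennreal (LINT \<omega>|lborel. 4 * exp (- T\<^sup>2 / 2) * ?G \<omega>)"
    by (intro nn_integral_eq_integral integrable_mult_right fourier_gaussian(1)) auto
  finally show ?thesis by (simp only: integral_mult_right_zero)
qed

text \<open>Split at \<open>R\<close>: the discrepancy bounds the profile inside, the Gaussian tails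
  of both laws outside.\<close>

lemma gaussian_mixture_profile_L1:
  fixes \<mu> \<nu> :: "'a::ordered_euclidean_space measure"
  assumes \<mu>: "\<mu> \<in> gaussian_mixture_class" and \<nu>: "\<nu> \<in> gaussian_mixture_class"
    and R: "R \<ge> 0" and v: "norm v \<le> 1"
  shows "(LINT b|lborel. \<bar>measure \<mu> {x. x \<bullet> v \<ge> b} - measure \<nu> {x. x \<bullet> v \<ge> b}\<bar>)
    \<le> 2 * R * perceptron_discrepancy \<mu> \<nu> + 2 * gauss_moment TYPE('a) * exp (- R\<^sup>2 / 16)
        * (LINT b|lborel. exp (- (sqrt (1 / 8) * norm (b::real))\<^sup>2 / 2))"
proof -
  note p = gaussian_mixtureD(1)[OF \<mu>] gaussian_mixtureD(1)[OF \<nu>]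
  let ?d = "perceptron_discrepancy \<mu> \<nu>"
  let ?M = "gauss_moment TYPE('a)"
  let ?G = "\<lambda>b::real. exp (- (sqrt (1 / 8) * norm b)\<^sup>2 / 2)"
  have d0: "?d \<ge> 0" by (rule perceptron_discrepancy_nonneg[OF p])
  have M0: "?M \<ge> 0" by (rule gauss_moment_nonneg)
  have I1: "integrable lborel (\<lambda>b. ?d * indicator {- R..R} b)"
    by (intro integrable_mult_right integrable_real_indicator) (auto simp: emeasure_lborel_Icc_eq)
  have I2: "integrable lborel (\<lambda>b. 2 * ?M * exp (- R\<^sup>2 / 16) * ?G b)"
    by (intro integrable_mult_right fourier_gaussian(1)) simp
  have b: "\<bar>measure \<mu> {x. x \<bullet> v \<ge> b} - measure \<nu> {x. x \<bullet> v \<ge> b}\<bar>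
      \<le> ?d * indicator {- R..R} b + 2 * ?M * exp (- R\<^sup>2 / 16) * ?G b" for b
  proof (cases "\<bar>b\<bar> \<le> R")
    case True
    have "0 \<le> 2 * ?M * exp (- R\<^sup>2 / 16) * ?G b" using M0 by simp
    then show ?thesis
      using abs_half_space_le_perceptron_discrepancy[OF p, of b v] True by (simp add: abs_le_iff)
  next
    case False
    have "\<bar>measure \<mu> {x. x \<bullet> v \<ge> b} - measure \<nu> {x. x \<bullet> v \<ge> b}\<bar> \<le> 2 * (?M * exp (- \<bar>b\<bar>\<^sup>2 / 8))"
      using abs_half_space_le_tail[OF p integrable_norm_gaussian_mixture[OF \<mu>] integrable_norm_gaussian_mixture[OF \<nu>] v, of b]
        gaussian_mixture_tail[OF \<mu>, of "\<bar>b\<bar>"] gaussian_mixture_tail[OF \<nu>, of "\<bar>b\<bar>"] by simp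
    \<comment> \<open>Half of the tail rate 1/8 is spent on smallness in \<open>R\<close>, the other
      half keeps the integral over \<open>b\<close> finite.\<close>
    also have "\<dots> \<le> 2 * (?M * exp (- R\<^sup>2 / 16 + - \<bar>b\<bar>\<^sup>2 / 16))"
    proof -
      have "R\<^sup>2 \<le> \<bar>b\<bar>\<^sup>2" using False R by (intro power_mono) auto
      then show ?thesis using M0 by (intro mult_left_mono) auto
    qed
    also have "\<dots> = 2 * ?M * exp (- R\<^sup>2 / 16) * ?G b"
      by (simp only: exp_add) (simp add: power_mult_distrib power_divide real_sqrt_divide)
    also have "\<dots> \<le> ?d * indicator {- R..R} b + 2 * ?M * exp (- R\<^sup>2 / 16) * ?G b" using d0 by simp
    finally show ?thesis .
  qed
  have "(LINT b|lborel. \<bar>measure \<mu> {x. x \<bullet> v \<ge> b} - measure \<nu> {x. x \<bullet> v \<ge> b}\<bar>)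
     \<le> (LINT b|lborel. ?d * indicator {- R..R} b + 2 * ?M * exp (- R\<^sup>2 / 16) * ?G b)"
    by (rule integral_mono'[OF Bochner_Integration.integrable_add[OF I1 I2] b]) (use d0 M0 in auto)
  also have "\<dots> = (LINT b|lborel. ?d * indicator {- R..R} b) + (LINT b|lborel. 2 * ?M * exp (- R\<^sup>2 / 16) * ?G b)"
    by (rule Bochner_Integration.integral_add[OF I1 I2])
  also have "(LINT b|lborel. ?d * indicator {- R..R} b) = 2 * R * ?d" using R by simp
  also have "(LINT b|lborel. 2 * ?M * exp (- R\<^sup>2 / 16) * ?G b) = 2 * ?M * exp (- R\<^sup>2 / 16) * (LINT b|lborel. ?G b)"
    by (rule integral_mult_right_zero)
  finally show ?thesis .
qed

text \<open>One parameter suffices: \<open>T = R\<close>, and the profile is split at the same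
  \<open>R\<close>. Under the square root the powers \<open>n\<close>, \<open>n + 1\<close> and 1 of
  \<open>R\<close> combine to \<open>2 * (n + 1)\<close>.\<close>

lemma gaussian_mixture_truncated_bound:
  "\<exists>C\<ge>0. \<forall>\<mu>\<in>gaussian_mixture_class. \<forall>\<nu>\<in>gaussian_mixture_class :: 'a::ordered_euclidean_space measure set. \<forall>R\<ge>1.
     total_variation \<mu> \<nu> \<le> C * R ^ (DIM('a) + 1) * (perceptron_discrepancy \<mu> \<nu> + exp (- R\<^sup>2 / 32))"
proof -
  define M where "M = gauss_moment TYPE('a)"
  define K where "K = (LINT b|lborel. exp (- (sqrt (1 / 8) * norm (b::real))\<^sup>2 / 2))"
  define L where "L = (LINT \<omega>|(lborel::'a measure). exp (- (1 * norm \<omega>)\<^sup>2 / 2))"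
  define u where "u = unit_ball_vol (real DIM('a))"
  define c where "c = 2 ^ DIM('a) * u * 8 * pi * exp 2"
  define B where "B = u * 2 ^ DIM('a) * (2 * c + c * (2 * M * K) + 4 * L)"
  have nonneg: "M \<ge> 0" "K \<ge> 0" "L \<ge> 0" "u \<ge> 0" "c \<ge> 0"
    by (auto simp: M_def K_def L_def u_def c_def gauss_moment_nonneg)
  then have B0: "B \<ge> 0" by (simp add: B_def)
  show ?thesis
  proof (intro exI[of _ "sqrt B + M"] conjI ballI allI impI)
    show "0 \<le> sqrt B + M" using B0 nonneg by simp
    fix \<mu> \<nu> :: "'a measure" and R :: real
    assume \<mu>: "\<mu> \<in> gaussian_mixture_class" and \<nu>: "\<nu> \<in> gaussian_mixture_class" and R: "R \<ge> 1"
    note p = gaussian_mixtureD(1)[OF \<mu>] gaussian_mixtureD(1)[OF \<nu>]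
    define d where "d = perceptron_discrepancy \<mu> \<nu>"
    \<comment> \<open>The slowest decay under the root is \<open>exp (- R\<^sup>2 / 16)\<close>,
      from the profile tails, and the root halves its rate. The truncated mass, of rate 1/8 outside
      the root, is also at most \<open>e\<close>.\<close>
    define e where "e = exp (- R\<^sup>2 / 32)"
    define n where "n = DIM('a)"
    have d: "0 \<le> d" "d \<le> 1"
      unfolding d_def by (rule perceptron_discrepancy_nonneg[OF p] perceptron_discrepancy_le_1[OF p])+
    have e: "0 \<le> e" by (simp add: e_def)
    have e2: "e\<^sup>2 = exp (- R\<^sup>2 / 16)" unfolding e_def by (simp add: exp_double[symmetric])
    have R0: "R \<ge> 0" "R > 0" using R by auto
    have compl: "- cball 0 R \<subseteq> {x::'a. norm x \<ge> R}" by auto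
    interpret finite_measure \<mu> using p(1) by (rule prob_dist_finite)
    have meas: "{x::'a. norm x \<ge> R} \<in> sets borel" by measurable
    have \<delta>: "measure \<mu> (- cball 0 R) \<le> M * exp (- R\<^sup>2 / 8)"
      using finite_measure_mono[OF compl] meas p(1) gaussian_mixture_tail[OF \<mu> R0(1)]
      by (simp add: prob_dist_def M_def)
    have "total_variation \<mu> \<nu> \<le> sqrt (u * (R + 1) ^ n *
        (2 ^ n * u * 8 * pi * exp 2 * R ^ (n + 1) * (d * (2 * R * d + 2 * M * exp (- R\<^sup>2 / 16) * K))
          + 4 * exp (- R\<^sup>2 / 2) * L)) + M * exp (- R\<^sup>2 / 8)"
      unfolding u_def n_def d_def
      by (rule total_variation_le_truncated[OF p integrable_norm_gaussian_mixture[OF \<mu>]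
            integrable_norm_gaussian_mixture[OF \<nu>] R0 \<delta>])
        (use gaussian_mixture_profile_L1[OF \<mu> \<nu> R0(1)] gaussian_mixture_high_frequency[OF \<mu> \<nu> R0(2)] nonneg
          in \<open>auto simp: M_def K_def L_def\<close>)
    also have "\<dots> \<le> sqrt (B * (R ^ (n + 1))\<^sup>2 * (d + e)\<^sup>2) + M * exp (- R\<^sup>2 / 8)"
    proof (intro add_right_mono real_sqrt_le_mono)
      have "R + 1 \<le> 2 * R" using R by simp
      then have 1: "u * (R + 1) ^ n \<le> u * 2 ^ n * R ^ n"
        using R0 nonneg unfolding mult.assoc power_mult_distrib[symmetric] by (intro mult_left_mono power_mono) auto
      have "d * (2 * R * d + 2 * M * exp (- R\<^sup>2 / 16) * K) = 2 * R * d\<^sup>2 + d * (2 * M * K * e\<^sup>2)"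
        unfolding e2 by (simp add: algebra_simps power2_eq_square)
      \<comment> \<open>The mixed term is handled by \<open>d \<le> 1 \<le> R\<close>, which leaves
        squares of \<open>d\<close> and \<open>e\<close> only.\<close>
      also have "\<dots> \<le> 2 * R * d\<^sup>2 + R * (2 * M * K * e\<^sup>2)"
        using d R nonneg by (intro add_left_mono mult_right_mono) auto
      finally have 2: "c * R ^ (n + 1) * (d * (2 * R * d + 2 * M * exp (- R\<^sup>2 / 16) * K))
         \<le> c * R ^ (n + 1) * (2 * R * d\<^sup>2 + R * (2 * M * K * e\<^sup>2))"
        using nonneg R0 by (intro mult_left_mono) auto
      have "4 * exp (- R\<^sup>2 / 2) * L \<le> 4 * e\<^sup>2 * L"
        unfolding e2 using nonneg by (intro mult_right_mono mult_left_mono) auto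
      also have "\<dots> \<le> R ^ (n + 2) * (4 * e\<^sup>2 * L)"
        using nonneg one_le_power[OF R, of "n + 2"] mult_right_mono[of 1 "R ^ (n + 2)" "4 * e\<^sup>2 * L"] by simp
      finally have "c * R ^ (n + 1) * (d * (2 * R * d + 2 * M * exp (- R\<^sup>2 / 16) * K)) + 4 * exp (- R\<^sup>2 / 2) * L
        \<le> c * R ^ (n + 1) * (2 * R * d\<^sup>2 + R * (2 * M * K * e\<^sup>2)) + R ^ (n + 2) * (4 * e\<^sup>2 * L)"
        using 2 by linarith
      also have "\<dots> = R ^ (n + 2) * (2 * c * d\<^sup>2 + (c * (2 * M * K) + 4 * L) * e\<^sup>2)"
        by (simp add: algebra_simps)
      also have "\<dots> \<le> R ^ (n + 2) * ((2 * c + c * (2 * M * K) + 4 * L) * (d + e)\<^sup>2)"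
      proof (rule mult_left_mono)
        have s: "d\<^sup>2 + e\<^sup>2 \<le> (d + e)\<^sup>2" using d e by (simp add: power2_sum)
        have "2 * c * d\<^sup>2 + (c * (2 * M * K) + 4 * L) * e\<^sup>2
          \<le> (2 * c + c * (2 * M * K) + 4 * L) * d\<^sup>2 + (2 * c + c * (2 * M * K) + 4 * L) * e\<^sup>2"
          using nonneg by (intro add_mono mult_right_mono) auto
        also have "\<dots> = (2 * c + c * (2 * M * K) + 4 * L) * (d\<^sup>2 + e\<^sup>2)" by (simp only: distrib_left)
        also have "\<dots> \<le> (2 * c + c * (2 * M * K) + 4 * L) * (d + e)\<^sup>2"
          using s nonneg by (intro mult_left_mono) auto
        finally show "2 * c * d\<^sup>2 + (c * (2 * M * K) + 4 * L) * e\<^sup>2 \<le> (2 * c + c * (2 * M * K) + 4 * L) * (d + e)\<^sup>2" .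
      qed (use R0 in auto)
      finally have 3: "c * R ^ (n + 1) * (d * (2 * R * d + 2 * M * exp (- R\<^sup>2 / 16) * K)) + 4 * exp (- R\<^sup>2 / 2) * L
        \<le> R ^ (n + 2) * ((2 * c + c * (2 * M * K) + 4 * L) * (d + e)\<^sup>2)" .
      have "u * (R + 1) ^ n * (c * R ^ (n + 1) * (d * (2 * R * d + 2 * M * exp (- R\<^sup>2 / 16) * K)) + 4 * exp (- R\<^sup>2 / 2) * L)
        \<le> u * 2 ^ n * R ^ n * (R ^ (n + 2) * ((2 * c + c * (2 * M * K) + 4 * L) * (d + e)\<^sup>2))"
        by (rule mult_mono[OF 1 3]) (use nonneg R0 d in auto)
      also have "\<dots> = B * (R ^ (n + 1))\<^sup>2 * (d + e)\<^sup>2"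
        unfolding B_def n_def[symmetric] by (simp add: power_add power2_eq_square algebra_simps)
      finally show "u * (R + 1) ^ n *
        (2 ^ n * u * 8 * pi * exp 2 * R ^ (n + 1) * (d * (2 * R * d + 2 * M * exp (- R\<^sup>2 / 16) * K))
          + 4 * exp (- R\<^sup>2 / 2) * L) \<le> B * (R ^ (n + 1))\<^sup>2 * (d + e)\<^sup>2"
        unfolding c_def n_def[symmetric] .
    qed
    also have "sqrt (B * (R ^ (n + 1))\<^sup>2 * (d + e)\<^sup>2) = sqrt B * R ^ (n + 1) * (d + e)"
      using R0 d e by (simp add: real_sqrt_mult)
    also have "M * exp (- R\<^sup>2 / 8) \<le> M * (R ^ (n + 1) * (d + e))"
    proof (rule mult_left_mono)
      have "exp (- R\<^sup>2 / 8) \<le> 1 * e" unfolding e_def by simp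
      also have "\<dots> \<le> R ^ (n + 1) * (d + e)"
        using d e one_le_power[OF R, of "n + 1"] by (intro mult_mono) auto
      finally show "exp (- R\<^sup>2 / 8) \<le> R ^ (n + 1) * (d + e)" .
    qed (rule nonneg)
    also have "sqrt B * R ^ (n + 1) * (d + e) + M * (R ^ (n + 1) * (d + e)) = (sqrt B + M) * R ^ (n + 1) * (d + e)"
      by (simp add: algebra_simps)
    finally show "total_variation \<mu> \<nu> \<le> (sqrt B + M) * R ^ (DIM('a) + 1) * (perceptron_discrepancy \<mu> \<nu> + exp (- R\<^sup>2 / 32))"
      unfolding n_def d_def e_def by simp
  qed
qed

text \<open>From \<open>(R - 8)\<^sup>2 \<ge> 0\<close> one gets
  \<open>R \<le> 4 * m * (1 + x / m)\<close> with \<open>x = R\<^sup>2 / 64\<close>, and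
  \<open>(1 + x / m) ^ m \<le> exp x\<close>. The rate 1/64 is half of the 1/32 in the mixture
  bound, so the power of \<open>R\<close> uses up only half of the decay.\<close>

lemma power_le_exp_square:
  fixes R :: real
  assumes m: "m \<ge> 1" and R: "R \<ge> 0"
  shows "R ^ m \<le> (4 * real m) ^ m * exp (R\<^sup>2 / 64)"
proof -
  have "0 \<le> (R - 8)\<^sup>2" by simp
  then have "16 * R \<le> 64 + R\<^sup>2" by (simp add: power2_diff)
  also have "\<dots> \<le> 64 * real m + R\<^sup>2" using m by simp
  finally have "R \<le> 4 * real m + R\<^sup>2 / 16" by simp
  also have "\<dots> = 4 * real m * (1 + R\<^sup>2 / 64 / real m)" using m by (simp add: field_simps)
  finally have "R \<le> 4 * real m * (1 + R\<^sup>2 / 64 / real m)" .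
  then have "R ^ m \<le> (4 * real m * (1 + R\<^sup>2 / 64 / real m)) ^ m" using R by (intro power_mono)
  also have "\<dots> = (4 * real m) ^ m * (1 + R\<^sup>2 / 64 / real m) ^ m" by (rule power_mult_distrib)
  also have "\<dots> \<le> (4 * real m) ^ m * exp (R\<^sup>2 / 64)"
    using m by (intro mult_left_mono exp_ge_one_plus_x_over_n_power_n)
      (auto intro: order_trans[of _ 0])
  finally show ?thesis .
qed

text \<open>The radius \<open>R = 8 * sqrt ((1 + k) * ln (3 + 1 / \<tau>))\<close> makes the Gaussian error at most \<open>\<tau> / 2\<close>.\<close>

lemma logarithmic_optimize:
  fixes C :: real
  assumes C: "C \<ge> 0" and m: "m \<ge> 1"
  shows "\<exists>C'. \<forall>\<tau> \<delta>. 0 < \<tau> \<longrightarrow> 0 \<le> \<delta> \<longrightarrow> (\<forall>R\<ge>1. \<tau> \<le> C * R ^ m * (\<delta> + exp (- R\<^sup>2 / 32)))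
      \<longrightarrow> \<tau> * ln (3 + 1 / \<tau>) powr (- real m / 2) \<le> C' * \<delta>"
proof -
  define D where "D = C * (4 * real m) ^ m"
  have D: "D \<ge> 0" using C by (simp add: D_def)
  \<comment> \<open>Since \<open>exp (2 * D) \<ge> 1 + 2 * D\<close>, this \<open>k\<close> gives
    \<open>D * exp (- k) \<le> 1 / 2\<close>. In \<open>1 + k\<close> the summand 1 produces
    \<open>exp (- L) \<le> \<tau>\<close>, and \<open>k\<close> compensates the constant
    \<open>D\<close>.\<close>
  define k where "k = 2 * D"
  define a where "a = 8 * sqrt (1 + k)"
  have k: "k \<ge> 0" using D by (simp add: k_def)
  then have a: "a \<ge> 1" "a\<^sup>2 = 64 * (1 + k)"
  proof -
    have "1 \<le> sqrt (1 + k)" using k by simp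
    then show "a \<ge> 1" unfolding a_def by linarith
    show "a\<^sup>2 = 64 * (1 + k)" using k by (simp add: a_def power_mult_distrib)
  qed
  show ?thesis
  proof (intro exI[of _ "2 * C * a ^ m"] allI impI)
    fix \<tau> \<delta> :: real
    assume \<tau>: "0 < \<tau>" and \<delta>: "0 \<le> \<delta>" and b: "\<forall>R\<ge>1. \<tau> \<le> C * R ^ m * (\<delta> + exp (- R\<^sup>2 / 32))"
    define L where "L = ln (3 + 1 / \<tau>)"
    \<comment> \<open>The 3 in the logarithm ensures \<open>L \<ge> 1\<close>, hence
      \<open>R \<ge> 1\<close>, and allows \<open>exp (- k * L)\<close> to be replaced by
      \<open>exp (- k)\<close>.\<close>
    have "exp 1 \<le> (3::real)" by (rule exp_le)
    also have "3 \<le> 3 + 1 / \<tau>" using \<tau> by simp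
    finally have L1: "L \<ge> 1" unfolding L_def using \<tau> by (subst ln_ge_iff) (auto intro: add_pos_pos)
    have eL: "exp (- L) \<le> \<tau>"
    proof -
      have "exp L = 3 + 1 / \<tau>" unfolding L_def using \<tau> by (intro exp_ln add_pos_pos) auto
      then have "1 / \<tau> \<le> exp L" by simp
      then show ?thesis using \<tau> by (simp add: exp_minus field_simps)
    qed
    define R where "R = a * sqrt L"
    have R2: "R\<^sup>2 = 64 * (1 + k) * L" using L1 a by (simp add: R_def power_mult_distrib)
    have R1: "R \<ge> 1"
      using mult_mono[of 1 a 1 "sqrt L"] a L1 by (simp add: R_def)
    have err: "C * R ^ m * exp (- R\<^sup>2 / 32) \<le> \<tau> / 2"
    proof -
      have "C * R ^ m * exp (- R\<^sup>2 / 32) \<le> C * ((4 * real m) ^ m * exp (R\<^sup>2 / 64)) * exp (- R\<^sup>2 / 32)"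
        using C R1 by (intro mult_right_mono mult_left_mono power_le_exp_square m) auto
      also have "\<dots> = D * (exp (R\<^sup>2 / 64) * exp (- R\<^sup>2 / 32))" by (simp add: D_def)
      also have "exp (R\<^sup>2 / 64) * exp (- R\<^sup>2 / 32) = exp (- L) * exp (- k * L)"
      proof -
        have "R\<^sup>2 / 64 + - R\<^sup>2 / 32 = - L + - k * L" unfolding R2 by (simp add: field_simps)
        then show ?thesis by (simp only: exp_add[symmetric])
      qed
      also have "D * (exp (- L) * exp (- k * L)) \<le> D * (\<tau> * exp (- k))"
        using eL D \<tau> k L1 mult_left_mono[OF L1 k] by (intro mult_left_mono mult_mono) auto
      also have "\<dots> = \<tau> * (D * exp (- k))" by simp
      also have "D * exp (- k) \<le> 1 / 2"
      proof -
        have "2 * D \<le> exp k" unfolding k_def using exp_ge_add_one_self[of "2 * D"] by linarith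
        then show ?thesis by (simp add: exp_minus field_simps)
      qed
      finally show ?thesis using \<tau> by (simp add: mult_left_mono)
    qed
    have "\<tau> \<le> C * R ^ m * (\<delta> + exp (- R\<^sup>2 / 32))" using b R1 by blast
    \<comment> \<open>The error is at most half of \<open>\<tau>\<close> and is absorbed on the
      left, which doubles the constant.\<close>
    then have "\<tau> \<le> 2 * C * R ^ m * \<delta>" using err by (simp add: algebra_simps)
    also have "R ^ m = a ^ m * L powr (real m / 2)"
    proof -
      have "sqrt L ^ m = (L powr (1 / 2)) powr (real m)"
        using L1 by (simp add: powr_half_sqrt powr_realpow)
      also have "\<dots> = L powr (real m / 2)" by (simp add: powr_powr)
      finally show ?thesis by (simp add: R_def power_mult_distrib)
    qed
    finally have "\<tau> * L powr (- real m / 2) \<le> 2 * C * (a ^ m * L powr (real m / 2)) * \<delta> * L powr (- real m / 2)"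
      by (intro mult_right_mono) auto
    also have "\<dots> = 2 * C * a ^ m * \<delta> * (L powr (real m / 2) * L powr (- real m / 2))" by simp
    also have "L powr (real m / 2) * L powr (- real m / 2) = 1"
      using L1 by (simp add: powr_add[symmetric])
    finally show "\<tau> * ln (3 + 1 / \<tau>) powr (- real m / 2) \<le> 2 * C * a ^ m * \<delta>"
      by (simp add: L_def)
  qed
qed

lemma gaussian_mixture_class_bound:
  "\<exists>C::real. \<forall>\<mu>\<in>gaussian_mixture_class. \<forall>\<nu>\<in>gaussian_mixture_class :: 'a::ordered_euclidean_space measure set.
        (if total_variation \<mu> \<nu> = 0 then 0
         else total_variation \<mu> \<nu>
              * ln (3 + 1 / total_variation \<mu> \<nu>) powr (- (real DIM('a) + 1) / 2))
        \<le> C * perceptron_discrepancy \<mu> \<nu>"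
proof -
  obtain C where C: "C \<ge> 0" and b: "\<And>\<mu> \<nu> R. \<mu> \<in> gaussian_mixture_class \<Longrightarrow> \<nu> \<in> gaussian_mixture_class \<Longrightarrow> R \<ge> 1 \<Longrightarrow>
     total_variation \<mu> (\<nu> :: 'a measure) \<le> C * R ^ (DIM('a) + 1) * (perceptron_discrepancy \<mu> \<nu> + exp (- R\<^sup>2 / 32))"
    using gaussian_mixture_truncated_bound[where 'a='a] by blast
  obtain C' where C': "\<And>\<tau> \<delta>. 0 < \<tau> \<Longrightarrow> 0 \<le> \<delta> \<Longrightarrow> (\<And>R. R \<ge> 1 \<Longrightarrow> \<tau> \<le> C * R ^ (DIM('a) + 1) * (\<delta> + exp (- R\<^sup>2 / 32)))
      \<Longrightarrow> \<tau> * ln (3 + 1 / \<tau>) powr (- real (DIM('a) + 1) / 2) \<le> C' * \<delta>"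
    using logarithmic_optimize[OF C, of "DIM('a) + 1"] by auto
  show ?thesis
  \<comment> \<open>\<open>logarithmic_optimize\<close> does not assert that \<open>C'\<close> is
    nonnegative, while the case of vanishing total variation needs a nonnegative right side.\<close>
  proof (intro exI[of _ "max C' 0"] ballI)
    fix \<mu> \<nu> :: "'a measure" assume \<mu>\<nu>: "\<mu> \<in> gaussian_mixture_class" "\<nu> \<in> gaussian_mixture_class"
    note p = gaussian_mixtureD(1)[OF \<mu>\<nu>(1)] gaussian_mixtureD(1)[OF \<mu>\<nu>(2)]
    let ?\<tau> = "total_variation \<mu> \<nu>" and ?d = "perceptron_discrepancy \<mu> \<nu>"
    have d0: "?d \<ge> 0" by (rule perceptron_discrepancy_nonneg[OF p])
    show "(if ?\<tau> = 0 then 0 else ?\<tau> * ln (3 + 1 / ?\<tau>) powr (- (real DIM('a) + 1) / 2)) \<le> max C' 0 * ?d"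
    proof (cases "?\<tau> = 0")
      case False
      then have "?\<tau> > 0" using total_variation_nonneg[OF p] by simp
      then have "?\<tau> * ln (3 + 1 / ?\<tau>) powr (- real (DIM('a) + 1) / 2) \<le> C' * ?d"
        using d0 b[OF \<mu>\<nu>] by (intro C')
      also have "\<dots> \<le> max C' 0 * ?d" using d0 by (intro mult_right_mono) auto
      finally show ?thesis using False by (simp add: add.commute)
    qed (use d0 in simp)
  qed
qed

theorem theorem2:
  "(\<forall>\<beta>>0. \<exists>C\<^sub>1::real.
      \<forall>\<mu>\<in>smooth_class \<beta>. \<forall>\<nu>\<in>smooth_class \<beta> :: (real ^ 'n) measure set.
        total_variation \<mu> \<nu> powr ((2 * \<beta> + real CARD('n) + 1) / (2 * \<beta>))
        \<le> C\<^sub>1 * ((measure_sobolev_norm \<beta> \<mu>)\<^sup>2 + (measure_sobolev_norm \<beta> \<nu>)\<^sup>2)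
                powr ((real CARD('n) + 1) / (4 * \<beta>))
            * perceptron_discrepancy \<mu> \<nu>)
   \<and>
   (\<exists>C\<^sub>2::real.
      \<forall>\<mu>\<in>gaussian_mixture_class. \<forall>\<nu>\<in>gaussian_mixture_class :: (real ^ 'n) measure set.
        (if total_variation \<mu> \<nu> = 0 then 0
         else total_variation \<mu> \<nu>
              * ln (3 + 1 / total_variation \<mu> \<nu>) powr (- (real CARD('n) + 1) / 2))
        \<le> C\<^sub>2 * perceptron_discrepancy \<mu> \<nu>)"
  using smooth_class_bound[where 'a="real ^ 'n"] gaussian_mixture_class_bound[where 'a="real ^ 'n"]
  unfolding DIM_cart DIM_real mult_1_right by blast

end
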